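(* Let $\widetilde C_n(\widetilde Y_n)$ be a credible set for $v$ in model (L) and let $C_n(Y_n):=\{f:\mathbb{L}u_f\in\widetilde C_n(Y_n-\tilde g)\}$. Then the credible levels of $\widetilde C_n(\widetilde Y_n)$ and $C_n(Y_n)$ are equal, and so are their coverage levels at $v_0$ and $f_0$ respectively. Let moreover $V_n\subseteq V$ be Borel sets and $\omega_n:[0,\infty)\to[0,\infty)$ non-decreasing functions with $\omega_n(t)\to0$ as $t\downarrow0$ such that $\|e(v)-e(v_0)\|_{L^2}\le\omega_n(\|v-v_0\|)$ for every $v\in V_n$. If $\widetilde C_n(\widetilde Y_n)\subseteq V_n$ and $\widetilde C_n(\widetilde Y_n)=\{v:\|v-\hat v_n\|\le r_n\}$ for some centre $\hat v_n$ and radius $r_n$, then on the event $\{v_0\in\widetilde C_n(\widetilde Y_n)\}$, $$\operatorname{diam}_{L^2}\bigl(C_n(Y_n)\bigr)\le2\,\omega_n(2r_n).$$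
   Context: Setting. $\mathcal{O}\subset\mathbb{R}^d$ is a bounded domain, $V=L^2(\mathcal{O})$ with norm $\|\cdot\|$, $\mathbb{L}$ is a linear differential operator with (homogeneous boundary condition) inverse $\mathcal{K}=\mathbb{L}^{-1}$, a bounded linear operator on $V$. For each $f$ in a parameter set $\mathcal{F}\subset L^2(\mathcal{O})$, $u_f$ denotes the solution of a semilinear PDE $\mathbb{L}u_f-C(u_f;f)=h$ with fixed known boundary data, and $\tilde g$ is the unique function with $\mathbb{L}\tilde g=0$ having the same boundary data, so that $u_f=\mathcal{K}\mathbb{L}u_f+\tilde g$. There is a solution map $e$, defined on elements of $V$, with $f=e(\mathbb{L}u_f)$. The true parameter is $f_0$, and $v_0=\mathbb{L}u_{f_0}$ (so $f_0=e(v_0)$). Model (N): one observes $Y_n=u_f+n^{-1/2}\Xi$ with $\Xi$ Gaussian white noise. Model (L): one observes $\widetilde Y_n=\mathcal{K}v+n^{-1/2}\Xi$; for $v=\mathbb{L}u_f$ this corresponds to $\widetilde Y_n=Y_n-\tilde g$. A prior $\widetilde\Pi_n$ is placed on $v$; $\widetilde\Pi_n(\cdot\mid\widetilde Y_n)$ is the posterior in model (L). The prior $\Pi_n$ on $f$ is the one induced via $f=e(v)$, i.e. under $\Pi_n$ the distribution of $\mathbb{L}u_f$ equals $\widetilde\Pi_n$; $\Pi_n(\cdot\mid Y_n)$ is the resulting posterior in model (N). The credible level of a data-dependent set is its posterior probability ($\widetilde\Pi_n(\widetilde C_n(\widetilde Y_n)\mid\widetilde Y_n)$, respectively $\Pi_n(C_n(Y_n)\mid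 Y_n)$); its (frequentist) coverage level is the probability, under the law of the data generated by the truth, that the set contains the truth ($v_0$, respectively $f_0$). $\operatorname{diam}_{L^2}$ is the diameter in the $L^2$-norm. *)

theory Defs
  imports "HOL-Probability.Probability"
begin

section \<open>The space of square integrable functions\<close>

definition square_integrable :: "(real^'d \<Rightarrow> real) \<Rightarrow> bool" where
  "square_integrable f \<longleftrightarrow>
     f \<in> borel_measurable lebesgue \<and> integrable lebesgue (\<lambda>x. (f x)\<^sup>2)"

definition L2_rel :: "(real^'d \<Rightarrow> real) \<Rightarrow> (real^'d \<Rightarrow> real) \<Rightarrow> bool" where
  "L2_rel f g \<longleftrightarrow> square_integrable f \<and> square_integrable g \<and> (AE x in lebesgue. f x = g x)"

lemma square_integrable_zero: "square_integrable (\<lambda>x. 0)"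
  by (simp add: square_integrable_def)

lemma square_integrable_mult:
  assumes "square_integrable f" "square_integrable g"
  shows "integrable lebesgue (\<lambda>x. f x * g x)"
proof (rule Bochner_Integration.integrable_bound)
  show "integrable lebesgue (\<lambda>x. (f x)\<^sup>2 + (g x)\<^sup>2)"
    using assms by (simp add: square_integrable_def)
  show "(\<lambda>x. f x * g x) \<in> borel_measurable lebesgue"
    using assms by (auto simp: square_integrable_def)
  have "\<bar>a * b\<bar> \<le> a\<^sup>2 + b\<^sup>2" for a b :: real
  proof -
    have "2 * (\<bar>a\<bar> * \<bar>b\<bar>) \<le> a\<^sup>2 + b\<^sup>2"
      using sum_squares_bound[of "\<bar>a\<bar>" "\<bar>b\<bar>"] by simp
    moreover have "0 \<le> \<bar>a\<bar> * \<bar>b\<bar>" by simp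
    ultimately show ?thesis unfolding abs_mult by linarith
  qed
  then show "AE x in lebesgue. norm (f x * g x) \<le> norm ((f x)\<^sup>2 + (g x)\<^sup>2)"
    by simp
qed

lemma square_integrable_scale:
  "square_integrable f \<Longrightarrow> square_integrable (\<lambda>x. c * f x)"
  by (auto simp: square_integrable_def power_mult_distrib)

lemma square_integrable_add:
  assumes "square_integrable f" "square_integrable g"
  shows "square_integrable (\<lambda>x. f x + g x)"
proof -
  have "integrable lebesgue (\<lambda>x. (f x)\<^sup>2 + (g x)\<^sup>2 + 2 * (f x * g x))"
    using assms square_integrable_mult[OF assms]
    by (auto simp: square_integrable_def)
  then show ?thesis
    using assms by (auto simp: square_integrable_def power2_sum algebra_simps)
qed

lemma square_integrable_uminus:
  "square_integrable f \<Longrightarrow> square_integrable (\<lambda>x. - f x)"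
  by (auto simp: square_integrable_def)

lemma square_integrable_diff:
  assumes "square_integrable f" "square_integrable g"
  shows "square_integrable (\<lambda>x. f x - g x)"
  using square_integrable_add[OF assms(1) square_integrable_uminus[OF assms(2)]] by simp

quotient_type 'd L2 = "real^'d \<Rightarrow> real" / partial: L2_rel
proof (rule part_equivpI)
  show "\<exists>f :: real^'d \<Rightarrow> real. L2_rel f f"
    by (rule exI[of _ "\<lambda>x. 0"]) (simp add: L2_rel_def square_integrable_zero)
  show "symp L2_rel"
    by (auto simp: symp_def L2_rel_def elim: AE_mp)
  show "transp L2_rel"
    unfolding transp_def L2_rel_def by (auto elim: eventually_elim2)
qed

instantiation L2 :: (finite) real_inner
begin

lift_definition zero_L2 :: "'a L2" is "\<lambda>x. 0"
  by (simp add: L2_rel_def square_integrable_zero)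

lift_definition plus_L2 :: "'a L2 \<Rightarrow> 'a L2 \<Rightarrow> 'a L2" is "\<lambda>f g x. f x + g x"
  by (auto simp: L2_rel_def intro: square_integrable_add elim: eventually_elim2)

lift_definition minus_L2 :: "'a L2 \<Rightarrow> 'a L2 \<Rightarrow> 'a L2" is "\<lambda>f g x. f x - g x"
  by (auto simp: L2_rel_def intro: square_integrable_diff elim: eventually_elim2)

lift_definition uminus_L2 :: "'a L2 \<Rightarrow> 'a L2" is "\<lambda>f x. - f x"
  by (auto simp: L2_rel_def intro: square_integrable_uminus)

lift_definition scaleR_L2 :: "real \<Rightarrow> 'a L2 \<Rightarrow> 'a L2" is "\<lambda>c f x. c * f x"
  by (auto simp: L2_rel_def intro: square_integrable_scale elim: eventually_mono)

lift_definition inner_L2 :: "'a L2 \<Rightarrow> 'a L2 \<Rightarrow> real" is "\<lambda>f g. (LINT x|lebesgue. f x * g x)"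
  by (rule integral_cong_AE)
     (auto simp: L2_rel_def square_integrable_def elim: eventually_elim2)

definition norm_L2 :: "'a L2 \<Rightarrow> real" where
  "norm_L2 v = sqrt (inner v v)"

definition dist_L2 :: "'a L2 \<Rightarrow> 'a L2 \<Rightarrow> real" where
  "dist_L2 v w = norm (v - w)"

definition sgn_L2 :: "'a L2 \<Rightarrow> 'a L2" where
  "sgn_L2 v = inverse (norm v) *\<^sub>R v"

definition uniformity_L2 :: "('a L2 \<times> 'a L2) filter" where
  "uniformity_L2 = (INF e\<in>{0<..}. principal {(x, y). dist x y < e})"

definition open_L2 :: "'a L2 set \<Rightarrow> bool" where
  "open_L2 S \<longleftrightarrow> (\<forall>x\<in>S. \<forall>\<^sub>F (x', y) in uniformity. x' = x \<longrightarrow> y \<in> S)"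

instance
proof
  fix u v w :: "'a L2" and a b :: real
  show "u + v + w = u + (v + w)"
    by transfer (auto simp: L2_rel_def algebra_simps intro!: square_integrable_add)
  show "u + v = v + u"
    by transfer (auto simp: L2_rel_def algebra_simps intro!: square_integrable_add)
  show "0 + u = u"
    by transfer (auto simp: L2_rel_def)
  show "- u + u = 0"
    by transfer (auto simp: L2_rel_def square_integrable_zero)
  show "u - v = u + - v"
    by transfer (auto simp: L2_rel_def intro!: square_integrable_diff)
  show "a *\<^sub>R (u + v) = a *\<^sub>R u + a *\<^sub>R v"
    by transfer (auto simp: L2_rel_def distrib_left
        intro!: square_integrable_add square_integrable_scale)
  show "(a + b) *\<^sub>R u = a *\<^sub>R u + b *\<^sub>R u"
    by transfer (auto simp: L2_rel_def distrib_right
        intro!: square_integrable_add square_integrable_scale)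
  show "a *\<^sub>R b *\<^sub>R u = (a * b) *\<^sub>R u"
    by transfer (auto simp: L2_rel_def mult.assoc intro!: square_integrable_scale)
  show "1 *\<^sub>R u = u"
    by transfer (auto simp: L2_rel_def)
  show "dist u v = norm (u - v)"
    by (rule dist_L2_def)
  show "sgn u = inverse (norm u) *\<^sub>R u"
    by (rule sgn_L2_def)
  show "(uniformity :: ('a L2 \<times> 'a L2) filter) = (INF e\<in>{0<..}. principal {(x, y). dist x y < e})"
    by (rule uniformity_L2_def)
  show "open S \<longleftrightarrow> (\<forall>x\<in>S. \<forall>\<^sub>F (x', y) in uniformity. x' = x \<longrightarrow> y \<in> S)" for S :: "'a L2 set"
    by (rule open_L2_def)
  show "inner u v = inner v u"
    by transfer (simp add: mult.commute)
  show "inner (u + v) w = inner u w + inner v w"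
    by transfer (simp add: L2_rel_def distrib_right square_integrable_mult)
  show "inner (a *\<^sub>R u) v = a * inner u v"
    by transfer (simp add: mult.assoc)
  show "0 \<le> inner u u"
    by transfer simp
  show "inner u u = 0 \<longleftrightarrow> u = 0"
  proof transfer
    fix f :: "real^'a \<Rightarrow> real"
    assume "L2_rel f f"
    then have f: "square_integrable f" by (simp add: L2_rel_def)
    then have "(LINT x|lebesgue. f x * f x) = 0 \<longleftrightarrow> (AE x in lebesgue. f x * f x = 0)"
      by (intro integral_nonneg_eq_0_iff_AE square_integrable_mult) auto
    then show "(LINT x|lebesgue. f x * f x) = 0 \<longleftrightarrow> L2_rel f (\<lambda>x. 0)"
      using f by (auto simp: L2_rel_def square_integrable_zero)
  qed
  show "norm u = sqrt (inner u u)"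
    by (rule norm_L2_def)
qed

end

text \<open>
  As types cannot depend on the domain \<open>U\<close>, the space \<open>L\<^sup>2(U)\<close> is identified, via
  extension by zero, with the closed subspace of those elements of \<open>L\<^sup>2(\<real>\<^sup>d)\<close> that vanish
  almost everywhere outside \<open>U\<close>. This identification is isometric, so norm, distance,
  diameter and Borel sets are the usual ones.
\<close>

definition L2_on :: "(real^'d) set \<Rightarrow> 'd L2 set" where
  "L2_on U = {v. AE x in lebesgue. x \<notin> U \<longrightarrow> rep_L2 v x = 0}"

abbreviation borel_on :: "'a::topological_space set \<Rightarrow> 'a measure" where
  "borel_on S \<equiv> restrict_space borel S"

section \<open>Linear differential operators\<close>

definition partial_deriv :: "'d \<Rightarrow> (real^'d \<Rightarrow> real) \<Rightarrow> real^'d \<Rightarrow> real" where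
  "partial_deriv i \<phi> x = frechet_derivative \<phi> (at x) (axis i 1)"

text \<open>A multi-index is given as the list of the coordinate directions to differentiate in.\<close>

definition partial_derivs :: "'d list \<Rightarrow> (real^'d \<Rightarrow> real) \<Rightarrow> real^'d \<Rightarrow> real" where
  "partial_derivs \<alpha> \<phi> = foldr partial_deriv \<alpha> \<phi>"

definition test_function :: "(real^'d) set \<Rightarrow> (real^'d \<Rightarrow> real) \<Rightarrow> bool" where
  "test_function U \<phi> \<longleftrightarrow>
     (\<forall>\<alpha> x. partial_derivs \<alpha> \<phi> differentiable (at x)) \<and>
     (\<exists>S. compact S \<and> S \<subseteq> U \<and> (\<forall>x. x \<notin> S \<longrightarrow> \<phi> x = 0))"

definition locally_integrable :: "(real^'d) set \<Rightarrow> (real^'d \<Rightarrow> real) \<Rightarrow> bool" where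
  "locally_integrable U f \<longleftrightarrow> (\<forall>S. compact S \<and> S \<subseteq> U \<longrightarrow> set_integrable lebesgue S f)"

definition weak_partial_derivs ::
  "(real^'d) set \<Rightarrow> 'd list \<Rightarrow> (real^'d \<Rightarrow> real) \<Rightarrow> (real^'d \<Rightarrow> real) \<Rightarrow> bool" where
  "weak_partial_derivs U \<alpha> f f' \<longleftrightarrow>
     locally_integrable U f \<and> locally_integrable U f' \<and>
     (\<forall>\<phi>. test_function U \<phi> \<longrightarrow>
        (LINT x:U|lebesgue. f' x * \<phi> x)
          = (-1) ^ length \<alpha> * (LINT x:U|lebesgue. f x * partial_derivs \<alpha> \<phi> x))"

text \<open>
  The operator is a finite sum of terms \<open>\<partial>\<^sup>\<beta>(a \<partial>\<^sup>\<alpha>w)\<close>, one for each triple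
  \<open>(\<beta>, a, \<alpha>)\<close> in the list: the inner derivative is a weak derivative, and the sum is taken in
  the sense of distributions. This covers operators in non-divergence form (\<open>\<beta> = []\<close>), in
  divergence form (both of length one), and distributional operators with smooth coefficients
  (\<open>\<alpha> = []\<close>).
\<close>

definition linear_differential_operator ::
  "(real^'d) set \<Rightarrow> 'd L2 set \<Rightarrow> ('d L2 \<Rightarrow> 'd L2) \<Rightarrow> bool" where
  "linear_differential_operator U D L \<longleftrightarrow>
     (\<exists>T :: ('d list \<times> (real^'d \<Rightarrow> real) \<times> 'd list) list.
        (\<forall>(\<beta>, a, \<alpha>) \<in> set T. set_borel_measurable lebesgue U a) \<and>
        (\<forall>w\<in>D. \<exists>W :: 'd list \<Rightarrow> real^'d \<Rightarrow> real.
           (\<forall>(\<beta>, a, \<alpha>) \<in> set T.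
              weak_partial_derivs U \<alpha> (rep_L2 w) (W \<alpha>) \<and>
              locally_integrable U (\<lambda>x. a x * W \<alpha> x)) \<and>
           (\<forall>\<phi>. test_function U \<phi> \<longrightarrow>
              (LINT x:U|lebesgue. rep_L2 (L w) x * \<phi> x)
                = (\<Sum>(\<beta>, a, \<alpha>)\<leftarrow>T. (-1) ^ length \<beta> *
                     (LINT x:U|lebesgue. a x * W \<alpha> x * partial_derivs \<beta> \<phi> x)))))"

section \<open>The semilinear inverse problem\<close>

definition linear_on :: "'a::real_vector set \<Rightarrow> ('a \<Rightarrow> 'b::real_vector) \<Rightarrow> bool" where
  "linear_on S T \<longleftrightarrow>
     (\<forall>x\<in>S. \<forall>y\<in>S. T (x + y) = T x + T y) \<and> (\<forall>c. \<forall>x\<in>S. T (c *\<^sub>R x) = c *\<^sub>R T x)"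

definition bounded_linear_on ::
  "'a::real_normed_vector set \<Rightarrow> ('a \<Rightarrow> 'b::real_normed_vector) \<Rightarrow> bool" where
  "bounded_linear_on S T \<longleftrightarrow> linear_on S T \<and> (\<exists>B. \<forall>x\<in>S. norm (T x) \<le> B * norm x)"

text \<open>
  \<open>D\<close> is the domain of the differential operator \<open>L\<close>, and \<open>bd\<close> assigns to the functions in
  \<open>D\<close> their boundary data, in an arbitrary real vector space; the prescribed boundary
  data are \<open>g\<close>. The identity \<open>u f = K (L (u f)) + gt\<close> is a consequence (lemma below).
\<close>

locale semilinear_inverse_problem =
  fixes U :: "(real^'d) set"
    and D :: "'d L2 set"
    and L :: "'d L2 \<Rightarrow> 'd L2"
    and bd :: "'d L2 \<Rightarrow> 'b::real_vector"
    and g :: 'b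
    and K :: "'d L2 \<Rightarrow> 'd L2"
    and C :: "'d L2 \<Rightarrow> 'd L2 \<Rightarrow> 'd L2"
    and h :: "'d L2"
    and F :: "'d L2 set"
    and u :: "'d L2 \<Rightarrow> 'd L2"
    and gt :: "'d L2"
    and e :: "'d L2 \<Rightarrow> 'd L2"
  assumes bounded_domain: "open U" "connected U" "bounded U" "U \<noteq> {}"
    and operator: "subspace D" "D \<subseteq> L2_on U" "L ` D \<subseteq> L2_on U" "linear_on D L"
      "linear_differential_operator U D L"
    and boundary: "linear_on D bd"
    and inverse_bounded: "K ` L2_on U \<subseteq> L2_on U" "bounded_linear_on (L2_on U) K"
    and inverse_right: "\<And>v. v \<in> L2_on U \<Longrightarrow> K v \<in> D \<and> bd (K v) = 0 \<and> L (K v) = v"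
    and inverse_left: "\<And>w. w \<in> D \<Longrightarrow> bd w = 0 \<Longrightarrow> K (L w) = w"
    and source: "h \<in> L2_on U"
    and parameters: "F \<subseteq> L2_on U"
    and solution: "\<And>f w. f \<in> F \<Longrightarrow> (w \<in> D \<and> bd w = g \<and> L w - C w f = h) \<longleftrightarrow> w = u f"
    and homogeneous: "\<And>w. (w \<in> D \<and> bd w = g \<and> L w = 0) \<longleftrightarrow> w = gt"
    and solution_map: "e \<in> borel_on (L2_on U) \<rightarrow>\<^sub>M borel_on (L2_on U)"
      "\<And>f. f \<in> F \<Longrightarrow> e (L (u f)) = f"
begin

lemma decomposition:
  assumes "f \<in> F"
  shows "u f = K (L (u f)) + gt"
proof -
  have u: "u f \<in> D" "bd (u f) = g" using solution[OF assms, of "u f"] by auto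
  have gt: "gt \<in> D" "bd gt = g" "L gt = 0" using homogeneous[of gt] by auto
  have neg: "- gt \<in> D" using gt(1) operator(1) by (rule subspace_neg[rotated])
  have scale: "bd (- gt) = - bd gt" "L (- gt) = - L gt"
    using boundary operator(4) gt(1) unfolding linear_on_def
    by (metis scaleR_minus1_left)+
  have "u f - gt \<in> D" using u(1) gt(1) operator(1) by (simp add: subspace_diff)
  moreover have "bd (u f - gt) = 0" "L (u f - gt) = L (u f)"
    using boundary operator(4) u neg gt scale unfolding linear_on_def
    by (metis add.right_inverse diff_conv_add_uminus, metis add.right_neutral diff_conv_add_uminus minus_zero)
  ultimately have "K (L (u f)) = u f - gt" using inverse_left[of "u f - gt"] by simp
  then show ?thesis by simp
qed

end

section \<open>Observation in Gaussian white noise\<close>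

definition gaussian :: "real \<Rightarrow> real \<Rightarrow> real measure" where
  "gaussian \<mu> \<sigma> = (if \<sigma> = 0 then return borel \<mu> else density lborel (normal_density \<mu> \<sigma>))"

text \<open>
  White noise on \<open>V\<close> is the iso-Gaussian process: centred, Gaussian, with covariance function
  equal to the inner product. Equivalently, as required here, every finite linear combination
  of its values has the centred normal law with the corresponding variance.
\<close>

definition white_noise :: "'w measure \<Rightarrow> 'h::real_inner set \<Rightarrow> ('h \<Rightarrow> 'w \<Rightarrow> real) \<Rightarrow> bool" where
  "white_noise M V \<Xi> \<longleftrightarrow>
     prob_space M \<and> (\<forall>\<phi>\<in>V. \<Xi> \<phi> \<in> borel_measurable M) \<and>
     (\<forall>J a. finite J \<and> J \<subseteq> V \<longrightarrow>
        distr M borel (\<lambda>\<omega>. \<Sum>\<phi>\<in>J. a \<phi> * \<Xi> \<phi> \<omega>) = gaussian 0 (norm (\<Sum>\<phi>\<in>J. a \<phi> *\<^sub>R \<phi>)))"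

text \<open>
  White noise is not a random element of \<open>V\<close>; an observation is a process indexed by the test
  elements \<open>\<phi> \<in> V\<close>, with a deterministic \<open>w \<in> V\<close> acting by \<open>\<phi> \<mapsto> \<langle>w, \<phi>\<rangle>\<close>.
\<close>

definition data_space :: "'h set \<Rightarrow> ('h \<Rightarrow> real) measure" where
  "data_space V = (\<Pi>\<^sub>M \<phi>\<in>V. borel)"

definition observation ::
  "'h::real_inner set \<Rightarrow> ('h \<Rightarrow> 'w \<Rightarrow> real) \<Rightarrow> nat \<Rightarrow> 'h \<Rightarrow> 'w \<Rightarrow> ('h \<Rightarrow> real)" where
  "observation V \<Xi> n w \<omega> = (\<lambda>\<phi>\<in>V. inner w \<phi> + \<Xi> \<phi> \<omega> / sqrt (real n))"

definition data_minus :: "'h::real_inner set \<Rightarrow> ('h \<Rightarrow> real) \<Rightarrow> 'h \<Rightarrow> ('h \<Rightarrow> real)" where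
  "data_minus V y w = (\<lambda>\<phi>\<in>V. y \<phi> - inner w \<phi>)"

definition data_law ::
  "'w measure \<Rightarrow> 'h::real_inner set \<Rightarrow> ('h \<Rightarrow> 'w \<Rightarrow> real) \<Rightarrow> nat \<Rightarrow> 'h \<Rightarrow> ('h \<Rightarrow> real) measure" where
  "data_law M V \<Xi> n w = distr M (data_space V) (observation V \<Xi> n w)"

section \<open>Priors, posteriors and credible sets\<close>

text \<open>
  \<open>\<kappa>\<close> is a version of the posterior, i.e. a regular conditional distribution of the parameter
  given the data \<open>X \<theta> \<omega>\<close>, if the parameter \<open>\<theta>\<close> has law \<open>P\<close> (the prior) and the noise
  \<open>\<omega>\<close>, independent of the parameter, has law \<open>M\<close>. It is determined only up to null sets
  of data, so statements on posterior probabilities are to be read almost surely.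
\<close>

definition posterior ::
  "'w measure \<Rightarrow> 'y measure \<Rightarrow> ('t \<Rightarrow> 'w \<Rightarrow> 'y) \<Rightarrow> 't measure \<Rightarrow> ('y \<Rightarrow> 't measure) \<Rightarrow> bool" where
  "posterior M Y X P \<kappa> \<longleftrightarrow>
     \<kappa> \<in> Y \<rightarrow>\<^sub>M prob_algebra P \<and>
     (\<forall>A\<in>sets P. \<forall>B\<in>sets Y.
        emeasure (P \<Otimes>\<^sub>M M) {(\<theta>, \<omega>) \<in> space (P \<Otimes>\<^sub>M M). \<theta> \<in> A \<and> X \<theta> \<omega> \<in> B}
          = (\<integral>\<^sup>+y\<in>B. emeasure (\<kappa> y) A \<partial>distr (P \<Otimes>\<^sub>M M) Y (\<lambda>(\<theta>, \<omega>). X \<theta> \<omega>)))"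

definition prior_on :: "'a::topological_space set \<Rightarrow> 'a measure \<Rightarrow> bool" where
  "prior_on S P \<longleftrightarrow> prob_space P \<and> sets P = sets (borel_on S)"

text \<open>Here \<open>A f\<close> stands for \<open>L (u f)\<close>.\<close>

definition induced_prior ::
  "'a::topological_space set \<Rightarrow> 'a set \<Rightarrow> ('a \<Rightarrow> 'a) \<Rightarrow> ('a \<Rightarrow> 'a) \<Rightarrow> 'a measure \<Rightarrow> 'a measure \<Rightarrow> bool" where
  "induced_prior V F A e Pt P \<longleftrightarrow>
     prior_on F P \<and>
     (\<forall>B\<in>sets P. emeasure P B = emeasure Pt {v \<in> V. e v \<in> B}) \<and>
     A \<in> P \<rightarrow>\<^sub>M borel_on V \<and> distr P (borel_on V) A = Pt"

text \<open>
  A data-dependent set, with a measurability condition under which its posterior probability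
  and its coverage are well defined (and the former is measurable in the data).
\<close>

definition measurable_set_estimator ::
  "'h::real_inner set \<Rightarrow> (('h \<Rightarrow> real) \<Rightarrow> 'h set) \<Rightarrow> bool" where
  "measurable_set_estimator V S \<longleftrightarrow>
     (\<forall>y\<in>space (data_space V). S y \<subseteq> V) \<and>
     {(y, v) \<in> space (data_space V \<Otimes>\<^sub>M borel_on V). v \<in> S y} \<in> sets (data_space V \<Otimes>\<^sub>M borel_on V)"

definition pulled_back_set ::
  "'h::real_inner set \<Rightarrow> 'h set \<Rightarrow> ('h \<Rightarrow> 'h) \<Rightarrow> 'h \<Rightarrow> (('h \<Rightarrow> real) \<Rightarrow> 'h set) \<Rightarrow> ('h \<Rightarrow> real) \<Rightarrow> 'h set" where
  "pulled_back_set V F A gt St y = {f \<in> F. A f \<in> St (data_minus V y gt)}"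

end

theory Submission
  imports Defs
begin

text \<open>
  Translation by the known function \<open>gt\<close> and the substitution \<open>v = L (u f)\<close> carry one model into
  the other. Since \<open>u f = K (L (u f)) + gt\<close>, subtracting \<open>gt\<close> from the data of model (N) at \<open>f\<close>
  gives, noise by noise, the data of model (L) at \<open>L (u f)\<close>; the pulled-back credible set contains
  \<open>f\<close> exactly if the original one, at the translated data, contains \<open>L (u f)\<close>; and
  \<open>f \<mapsto> L (u f)\<close> pushes the prior on \<open>f\<close> to the prior on \<open>v\<close>. Equality of the coverages
  is then a change of variables, and the bound on the diameter is the triangle inequality through
  \<open>f0 = e v0\<close>.

  The equality of the credible levels needs more, because posteriors are only determined up to
  null sets. In both models the integral of the posterior mass over a set of data is a
  probability under the joint law of parameter and data (\<open>posterior_disintegration\<close>). These joint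
  probabilities agree after the change of variables, and so the two credible levels agree for almost
  all data under the marginal law that the prior induces on the data (\<open>AE_posterior_mass_eq\<close>).

  The claim, however, is about the law of the data at each fixed \<open>f\<close>, whereas the prior may give
  mass zero to \<open>f\<close>. Here the Gaussian noise enters: by the Cameron-Martin theorem
  (\<open>data_law_eq_density\<close>), the laws of the data for any two signals in \<open>V\<close> have the same null sets.
  A null set of the marginal law is a null set for at least one parameter, hence for all of them
  (\<open>AE_data_law_of_AE_marginal\<close>).

  The Cameron-Martin theorem is proved on the level of characteristic functions. An exponentially
  tilted noise has the finite-dimensional characteristic functions of the shifted noise, and these
  determine the law on the product \<open>\<sigma>\<close>-algebra. The last fact is reduced to Levy's uniqueness
  theorem on the real line (\<open>measure_cylinder_eq\<close>).
\<close>

section \<open>Uniqueness of finite-dimensional laws\<close>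

text \<open>
  The value of the characteristic function at zero is the total mass, so that Levy's theorem for
  probability measures applies after normalisation. Weighted measures, which are not
  normalised, need this version.
\<close>

lemma finite_measure_eqI_char:
  fixes \<mu> \<nu> :: "real measure"
  assumes fin: "finite_measure \<mu>" "finite_measure \<nu>"
    and sets: "sets \<mu> = sets borel" "sets \<nu> = sets borel"
    and char: "\<And>t. char \<mu> t = char \<nu> t"
  shows "\<mu> = \<nu>"
proof -
  define c where "c = measure \<mu> UNIV"
  have space: "space \<mu> = UNIV" "space \<nu> = UNIV"
    using sets[THEN sets_eq_imp_space_eq] by auto
  have mass: "measure \<nu> UNIV = c"
    using char[of 0] space by (simp add: char_def c_def)
  have total: "emeasure \<mu> UNIV = ennreal c" "emeasure \<nu> UNIV = ennreal c"
    using fin[THEN finite_measure.emeasure_eq_measure] mass by (auto simp: c_def)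
  show ?thesis
  proof (cases "c = 0")
    case True
    have "emeasure \<mu> S = 0" "emeasure \<nu> S = 0" for S
      using emeasure_space[of \<mu> S] emeasure_space[of \<nu> S] total True space by auto
    then show ?thesis by (intro measure_eqI) (auto simp: sets)
  next
    case False
    then have c: "c > 0" by (simp add: c_def zero_less_measure_iff)
    define normed where "normed N = density N (\<lambda>_. ennreal (1 / c))" for N :: "real measure"
    have real_distribution: "real_distribution (normed N)"
      if "sets N = sets borel" "emeasure N UNIV = ennreal c" for N
    proof -
      have sp: "space N = UNIV" using that(1)[THEN sets_eq_imp_space_eq] by simp
      have "prob_space (normed N)"
        by (rule prob_spaceI)
           (use that sp c in \<open>simp add: normed_def emeasure_density nn_integral_cmult
             flip: ennreal_mult\<close>)
      then show ?thesis using that(1) sp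
        by (simp add: real_distribution_def real_distribution_axioms_def normed_def)
    qed
    have char_normed: "char (normed N) t = (1 / c) * char N t" if "sets N = sets borel" for N t
      unfolding char_def normed_def
      by (subst integral_density)
        (use that c in \<open>auto simp: measurable_cong_sets[OF that refl] scaleR_conv_of_real\<close>)
    have "normed \<mu> = normed \<nu>"
      using real_distribution sets total char
      by (intro Levy_uniqueness) (auto simp: fun_eq_iff char_normed)
    moreover have "N = density (normed N) (\<lambda>_. ennreal c)" if "sets N = sets borel" for N
      unfolding normed_def using c
      by (subst density_density_eq) (auto simp: density_1 simp flip: ennreal_mult)
    ultimately show ?thesis using sets by metis
  qed
qed

lemma integrable_iexp:
  fixes Z :: "'a \<Rightarrow> real"
  assumes "finite_measure M" and [measurable]: "Z \<in> borel_measurable M"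
  shows "integrable M (\<lambda>x. iexp (Z x))"
proof -
  interpret finite_measure M by fact
  show ?thesis by (rule integrable_const_bound[where B=1]) auto
qed

text \<open>
  The trigonometric weight \<open>cos (Z + s)\<close> takes both signs. Adding one turns it into the density
  of a positive measure, for which uniqueness is known.
\<close>

definition cosine_weighted_law ::
  "'a measure \<Rightarrow> ('a \<Rightarrow> real) \<Rightarrow> ('a \<Rightarrow> real) \<Rightarrow> real \<Rightarrow> real measure" where
  "cosine_weighted_law M X Z s = distr (density M (\<lambda>x. ennreal (1 + cos (Z x + s)))) borel X"

lemma one_plus_cos_nonneg: "0 \<le> 1 + cos (x :: real)"
  using cos_ge_minus_one[of x] by linarith

text \<open>
  By Euler's formula the joint characteristic function of \<open>X\<close> and \<open>Z\<close> determines the one of the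
  weighted law. The terms \<open>0 * Z\<close> and \<open>1 * Z\<close> are kept so that every summand is literally an
  instance of the joint characteristic function.
\<close>

lemma char_cosine_weighted_law:
  assumes M: "finite_measure M" and [measurable]: "X \<in> borel_measurable M" "Z \<in> borel_measurable M"
  shows "char (cosine_weighted_law M X Z s) t =
      (CLINT x|M. iexp (t * X x + 0 * Z x))
      + iexp s / 2 * (CLINT x|M. iexp (t * X x + 1 * Z x))
      + iexp (- s) / 2 * (CLINT x|M. iexp (t * X x + (-1) * Z x))"
proof -
  have "char (cosine_weighted_law M X Z s) t = (CLINT x|M. (1 + cos (Z x + s)) *\<^sub>R iexp (t * X x))"
    unfolding char_def cosine_weighted_law_def
    by (subst integral_distr, simp, simp, subst integral_density) (auto simp: one_plus_cos_nonneg)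
  also have "\<dots> = (CLINT x|M. iexp (t * X x + 0 * Z x)
      + iexp s / 2 * iexp (t * X x + 1 * Z x) + iexp (- s) / 2 * iexp (t * X x + (-1) * Z x))"
  proof (rule Bochner_Integration.integral_cong[OF refl])
    fix x
    have "complex_of_real (cos y) = (iexp y + iexp (- y)) / 2" for y :: real
      by (simp add: cos_of_real[symmetric] cos_exp_eq)
    then have "(1 + cos (Z x + s)) *\<^sub>R iexp (t * X x)
        = (1 + (iexp (Z x + s) + iexp (- (Z x + s))) / 2) * iexp (t * X x)"
      by (simp only: scaleR_conv_of_real of_real_add of_real_1)
    then show "(1 + cos (Z x + s)) *\<^sub>R iexp (t * X x) = iexp (t * X x + 0 * Z x)
      + iexp s / 2 * iexp (t * X x + 1 * Z x) + iexp (- s) / 2 * iexp (t * X x + (-1) * Z x)"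
      by (simp add: exp_add exp_diff exp_minus field_simps)
  qed
  also have "\<dots> = (CLINT x|M. iexp (t * X x + 0 * Z x))
    + iexp s / 2 * (CLINT x|M. iexp (t * X x + 1 * Z x))
    + iexp (- s) / 2 * (CLINT x|M. iexp (t * X x + (-1) * Z x))"
  proof -
    have i: "integrable M (\<lambda>x. iexp (t * X x + r * Z x))" for r
      by (rule integrable_iexp[OF M]) simp
    show ?thesis
      by (subst Bochner_Integration.integral_add Bochner_Integration.integral_mult_right_zero
           | intro Bochner_Integration.integrable_add integrable_mult_right i refl)+
  qed
  finally show ?thesis .
qed

lemma finite_measure_cosine_weighted_law:
  assumes "finite_measure M" and [measurable]: "X \<in> borel_measurable M" "Z \<in> borel_measurable M"
  shows "finite_measure (cosine_weighted_law M X Z s)"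
proof -
  interpret finite_measure M by fact
  have "1 + cos x \<le> 2" for x :: real using cos_le_one[of x] by linarith
  then have "integrable M (\<lambda>x. 1 + cos (Z x + s))"
    by (intro integrable_const_bound[where B=2]) (auto intro!: AE_I2 simp: one_plus_cos_nonneg)
  then have "finite_measure (density M (\<lambda>x. ennreal (1 + cos (Z x + s))))"
    by (intro finite_measureI)
       (auto simp: emeasure_density nn_integral_eq_integral one_plus_cos_nonneg cong: nn_integral_cong_simp)
  then show ?thesis
    unfolding cosine_weighted_law_def by (intro finite_measure.finite_measure_distr) auto
qed

lemma integrable_mult_cos:
  fixes f Z :: "'a \<Rightarrow> real"
  assumes "integrable M f" and [measurable]: "Z \<in> borel_measurable M"
  shows "integrable M (\<lambda>x. f x * cos (Z x))"
  using assms(1)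
  by (rule Bochner_Integration.integrable_bound)
     (use borel_measurable_integrable[OF assms(1)] in \<open>auto simp: abs_mult intro!: mult_left_le\<close>)

lemma integral_cosine_weighted_law:
  assumes [measurable]: "X \<in> borel_measurable M" "Z \<in> borel_measurable M" "f \<in> borel_measurable borel"
    and int: "integrable M (\<lambda>x. f (X x))"
  shows "(LINT x|cosine_weighted_law M X Z s. f x)
      = (LINT x|distr M borel X. f x) + (LINT x|M. f (X x) * cos (Z x + s))"
proof -
  have "(LINT x|cosine_weighted_law M X Z s. f x) = (LINT x|M. (1 + cos (Z x + s)) * f (X x))"
    unfolding cosine_weighted_law_def
    by (subst integral_distr, simp, simp, subst integral_density) (auto simp: one_plus_cos_nonneg)
  also have "\<dots> = (LINT x|M. f (X x) + f (X x) * cos (Z x + s))"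
    by (simp add: algebra_simps)
  finally show ?thesis
    using int integrable_mult_cos[OF int, of "\<lambda>x. Z x + s"] by (simp add: integral_distr)
qed

lemma integral_mult_iexp:
  fixes f Z :: "'a \<Rightarrow> real"
  assumes int: "integrable M f" and [measurable]: "Z \<in> borel_measurable M"
  shows "(CLINT x|M. f x * iexp (Z x))
      = of_real (LINT x|M. f x * cos (Z x + 0)) + \<i> * of_real (LINT x|M. f x * cos (Z x + (- pi / 2)))"
proof -
  have euler: "iexp y = of_real (cos (y + 0)) + \<i> * of_real (cos (y + (- pi / 2)))" for y :: real
    by (simp add: cis_conv_exp[symmetric] complex_eq_iff cos_diff)
  have "(CLINT x|M. f x * iexp (Z x))
    = (CLINT x|M. complex_of_real (f x * cos (Z x + 0)) + \<i> * complex_of_real (f x * cos (Z x + (- pi / 2))))"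
    unfolding euler of_real_mult by (simp only: ring_distribs mult_ac)
  also have "\<dots> = (CLINT x|M. complex_of_real (f x * cos (Z x + 0)))
      + (CLINT x|M. \<i> * complex_of_real (f x * cos (Z x + (- pi / 2))))"
    by (rule Bochner_Integration.integral_add;
        intro integrable_mult_right integrable_of_real integrable_mult_cos int; measurable)
  finally show ?thesis
    unfolding integral_mult_right_zero integral_complex_of_real .
qed

text \<open>
  The passage from one dimension to two: equal joint characteristic functions give equal
  laws of \<open>X\<close> under each of the positive weights \<open>1 + cos (Z + s)\<close>; taking \<open>s = 0\<close> and
  \<open>s = - pi / 2\<close> recovers the real and the imaginary part of the weight \<open>iexp Z\<close>.
\<close>

lemma integral_weighted_iexp_eq:
  fixes X1 Z1 :: "'a \<Rightarrow> real" and X2 Z2 :: "'b \<Rightarrow> real" and f :: "real \<Rightarrow> real"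
  assumes fin: "finite_measure M1" "finite_measure M2"
    and meas[measurable]: "X1 \<in> borel_measurable M1" "Z1 \<in> borel_measurable M1"
      "X2 \<in> borel_measurable M2" "Z2 \<in> borel_measurable M2"
    and eq: "\<And>s t. (CLINT x|M1. iexp (t * X1 x + s * Z1 x)) = (CLINT x|M2. iexp (t * X2 x + s * Z2 x))"
    and f[measurable]: "f \<in> borel_measurable borel"
    and int: "integrable M1 (\<lambda>x. f (X1 x))" "integrable M2 (\<lambda>x. f (X2 x))"
  shows "(CLINT x|M1. f (X1 x) * iexp (Z1 x)) = (CLINT x|M2. f (X2 x) * iexp (Z2 x))"
proof -
  have law_weighted: "cosine_weighted_law M1 X1 Z1 s = cosine_weighted_law M2 X2 Z2 s" for s
  proof (rule finite_measure_eqI_char)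
    show "char (cosine_weighted_law M1 X1 Z1 s) t = char (cosine_weighted_law M2 X2 Z2 s) t" for t
      by (simp only: char_cosine_weighted_law[OF fin(1) meas(1,2)]
          char_cosine_weighted_law[OF fin(2) meas(3,4)] eq)
  qed (use fin in \<open>auto intro!: finite_measure_cosine_weighted_law simp: cosine_weighted_law_def[THEN arg_cong[where f=sets]]\<close>)
  have law: "distr M1 borel X1 = distr M2 borel X2"
  proof (rule finite_measure_eqI_char)
    show "char (distr M1 borel X1) t = char (distr M2 borel X2) t" for t
      using eq[of t 0] by (simp add: char_def integral_distr)
  qed (use fin in \<open>auto intro!: finite_measure.finite_measure_distr\<close>)
  have "(LINT x|M1. f (X1 x) * cos (Z1 x + s)) = (LINT x|M2. f (X2 x) * cos (Z2 x + s))" for s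
    using integral_cosine_weighted_law[OF meas(1,2) f int(1), of s]
      integral_cosine_weighted_law[OF meas(3,4) f int(2), of s] law_weighted[of s] law by simp
  then show ?thesis
    by (simp only: integral_mult_iexp[OF int(1) meas(2)] integral_mult_iexp[OF int(2) meas(4)])
qed

lemma finite_measure_density_indicator:
  assumes "finite_measure M" and [measurable]: "X \<in> borel_measurable M" "A \<in> sets borel"
  shows "finite_measure (density M (\<lambda>x. ennreal (indicator A (X x))))"
proof -
  interpret finite_measure M by fact
  have "integrable M (\<lambda>x. indicator A (X x) :: real)"
    by (rule integrable_const_bound[where B=1]) auto
  then show ?thesis
    by (intro finite_measureI)
       (auto simp: emeasure_density nn_integral_eq_integral cong: nn_integral_cong_simp)
qed

lemma measure_density_indicator:
  assumes [measurable]: "X \<in> borel_measurable M" "A \<in> sets borel" "{x \<in> space M. P x} \<in> sets M"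
  shows "measure (density M (\<lambda>x. ennreal (indicator A (X x)))) {x \<in> space M. P x}
    = measure M {x \<in> space M. X x \<in> A \<and> P x}"
proof -
  have "{x \<in> space M. X x \<in> A \<and> P x} = {x \<in> space M. P x} \<inter> (X -` A \<inter> space M)"
    by auto
  then have [measurable]: "{x \<in> space M. X x \<in> A \<and> P x} \<in> sets M"
    by simp
  have "emeasure (density M (\<lambda>x. ennreal (indicator A (X x)))) {x \<in> space M. P x}
     = (\<integral>\<^sup>+x. indicator {x \<in> space M. X x \<in> A \<and> P x} x \<partial>M)"
    by (subst emeasure_density) (auto intro!: nn_integral_cong simp del: nn_integral_indicator split: split_indicator)
  then show ?thesis by (simp add: measure_def)
qed

text \<open>
  The multivariate uniqueness theorem, by induction on the number of coordinates. Restricting both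
  measures to the event in the new coordinate keeps the characteristic functions of the
  remaining coordinates equal, by \<open>integral_weighted_iexp_eq\<close> with an indicator
  as \<open>f\<close>. The measures must be general in the induction because this restriction changes them
  (and their total mass).
\<close>

lemma measure_cylinder_eq:
  fixes X :: "'j \<Rightarrow> 'a \<Rightarrow> real" and Y :: "'j \<Rightarrow> 'b \<Rightarrow> real"
  assumes "finite J" "finite_measure M" "finite_measure N"
    and "\<And>j. j \<in> J \<Longrightarrow> X j \<in> borel_measurable M" "\<And>j. j \<in> J \<Longrightarrow> Y j \<in> borel_measurable N"
    and "\<And>t. (CLINT x|M. iexp (\<Sum>j\<in>J. t j * X j x)) = (CLINT x|N. iexp (\<Sum>j\<in>J. t j * Y j x))"
    and "\<And>j. j \<in> J \<Longrightarrow> A j \<in> sets borel"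
  shows "measure M {x \<in> space M. \<forall>j\<in>J. X j x \<in> A j} = measure N {x \<in> space N. \<forall>j\<in>J. Y j x \<in> A j}"
  using assms
proof (induction J arbitrary: M N)
  case empty
  then show ?case by simp
next
  case (insert i J)
  note finJ[simp] = \<open>finite J\<close>
  have A[measurable]: "A i \<in> sets borel" and AJ[measurable]: "\<And>j. j \<in> J \<Longrightarrow> A j \<in> sets borel"
    and X[measurable]: "X i \<in> borel_measurable M" "\<And>j. j \<in> J \<Longrightarrow> X j \<in> borel_measurable M"
    and Y[measurable]: "Y i \<in> borel_measurable N" "\<And>j. j \<in> J \<Longrightarrow> Y j \<in> borel_measurable N"
    using insert.prems by auto
  let ?M = "density M (\<lambda>x. ennreal (indicator (A i) (X i x)))"
  let ?N = "density N (\<lambda>x. ennreal (indicator (A i) (Y i x)))"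
  have "measure ?M {x \<in> space ?M. \<forall>j\<in>J. X j x \<in> A j} = measure ?N {x \<in> space ?N. \<forall>j\<in>J. Y j x \<in> A j}"
  proof (rule insert.IH)
    fix t :: "'j \<Rightarrow> real"
    \<comment> \<open>Splitting off the coordinate \<open>i\<close> turns a combination over \<open>insert i J\<close> into one of the
      two variables \<open>X i\<close> and \<open>\<Sum>j\<in>J. t j * X j\<close>.\<close>
    have merge: "r * c i + s * (\<Sum>j\<in>J. t j * c j)
        = (\<Sum>j\<in>insert i J. (if j = i then r else s * t j) * c j)" for c :: "'j \<Rightarrow> real" and r s
      using \<open>i \<notin> J\<close> by (auto simp: sum_distrib_left mult.assoc intro!: sum.cong)
    have "(CLINT x|M. complex_of_real (indicator (A i) (X i x)) * iexp (\<Sum>j\<in>J. t j * X j x))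
      = (CLINT x|N. complex_of_real (indicator (A i) (Y i x)) * iexp (\<Sum>j\<in>J. t j * Y j x))"
    proof (rule integral_weighted_iexp_eq[where f="indicator (A i)" and ?X1.0="X i" and ?X2.0="Y i"])
      show "(CLINT x|M. iexp (r * X i x + s * (\<Sum>j\<in>J. t j * X j x)))
        = (CLINT x|N. iexp (r * Y i x + s * (\<Sum>j\<in>J. t j * Y j x)))" for r s
        using insert.prems(5)[of "\<lambda>j. if j = i then r else s * t j"]
        by (simp only: merge[where c="\<lambda>j. X j x" for x] merge[where c="\<lambda>j. Y j x" for x])
      show "integrable M (\<lambda>x. indicator (A i) (X i x) :: real)"
        by (rule finite_measure.integrable_const_bound[OF insert.prems(1), where B=1]) auto
      show "integrable N (\<lambda>x. indicator (A i) (Y i x) :: real)"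
        by (rule finite_measure.integrable_const_bound[OF insert.prems(2), where B=1]) auto
    qed (use insert.prems(1,2) in auto)
    then show "(CLINT x|?M. iexp (\<Sum>j\<in>J. t j * X j x)) = (CLINT x|?N. iexp (\<Sum>j\<in>J. t j * Y j x))"
      by (simp add: integral_density scaleR_conv_of_real)
  qed (use insert.prems(1,2) in \<open>auto intro!: finite_measure_density_indicator\<close>)
  then show ?case
    using measure_density_indicator[OF X(1) A, of "\<lambda>x. \<forall>j\<in>J. X j x \<in> A j"]
      measure_density_indicator[OF Y(1) A, of "\<lambda>x. \<forall>j\<in>J. Y j x \<in> A j"]
    by simp
qed

section \<open>Exponentially tilted white noise\<close>

lemma integral_pair_measure_mult:
  fixes F :: "'a \<Rightarrow> complex" and G :: "'b \<Rightarrow> complex"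
  assumes "pair_sigma_finite M1 M2" and F: "integrable M1 F" and G: "integrable M2 G"
  shows "(CLINT z|M1 \<Otimes>\<^sub>M M2. F (fst z) * G (snd z)) = (CLINT x|M1. F x) * (CLINT y|M2. G y)"
proof -
  interpret pair_sigma_finite M1 M2 by fact
  have [measurable]: "F \<in> borel_measurable M1" "G \<in> borel_measurable M2" using F G by auto
  have "integrable (M1 \<Otimes>\<^sub>M M2) (\<lambda>(x, y). F x * G y)"
  proof (rule Fubini_integrable)
    show "integrable M1 (\<lambda>x. LINT y|M2. norm (case (x, y) of (x, y) \<Rightarrow> F x * G y))"
      using F by (simp add: norm_mult)
  qed (use G in auto)
  from integral_fst[OF this] show ?thesis by (simp add: case_prod_beta')
qed

text \<open>
  Completing the square: the weight \<open>exp (b * x)\<close> shifts the standard normal density by \<open>b\<close>.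
\<close>

lemma std_normal_exponential_tilt:
  fixes a b :: real
  shows "integrable std_normal_distribution (\<lambda>x. exp (b * x))"
    and "(CLINT x|std_normal_distribution. exp (b * x) * iexp (a * x))
      = exp (b\<^sup>2 / 2) * iexp (a * b) * exp (- a\<^sup>2 / 2)"
proof -
  have shift: "std_normal_density (b + x) * exp (b * (b + x)) = exp (b\<^sup>2 / 2) * std_normal_density x" for x
    by (simp add: std_normal_density_def mult_exp_exp power2_eq_square algebra_simps add_divide_distrib)
       (simp add: field_simps flip: exp_add)
  have "integrable lborel (\<lambda>x. exp (b\<^sup>2 / 2) * std_normal_density x)"
    by (intro integrable_mult_right integrable_normal_density) simp
  then have "integrable lborel (\<lambda>x. std_normal_density (b + 1 * x) * exp (b * (b + 1 * x)))"
    by (simp add: shift)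
  then have "integrable lborel (\<lambda>x. std_normal_density x * exp (b * x))"
    by (subst (asm) lborel_integrable_real_affine_iff[where f="\<lambda>x. std_normal_density x * exp (b * x)"]) auto
  then show "integrable std_normal_distribution (\<lambda>x. exp (b * x))"
    by (subst integrable_density) auto
  have "(CLINT x|std_normal_distribution. exp (b * x) * iexp (a * x))
     = (CLINT x|lborel. complex_of_real (std_normal_density x * exp (b * x)) * iexp (a * x))"
    by (subst integral_density) (auto simp: scaleR_conv_of_real mult.assoc)
  also have "\<dots> = (CLINT x|lborel. complex_of_real (std_normal_density (b + 1 * x) * exp (b * (b + 1 * x))) * iexp (a * (b + 1 * x)))"
    by (subst lborel_integral_real_affine[where c=1 and t=b]) auto
  also have "\<dots> = (CLINT x|lborel. (exp (b\<^sup>2 / 2) * iexp (a * b)) * (std_normal_density x *\<^sub>R iexp (a * x)))"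
    by (intro Bochner_Integration.integral_cong refl)
       (simp only: mult_1 shift, simp add: scaleR_conv_of_real ring_distribs exp_add mult_ac)
  also have "\<dots> = (exp (b\<^sup>2 / 2) * iexp (a * b)) * char std_normal_distribution a"
    unfolding char_def integral_mult_right_zero by (subst integral_density) auto
  finally show "(CLINT x|std_normal_distribution. exp (b * x) * iexp (a * x))
      = exp (b\<^sup>2 / 2) * iexp (a * b) * exp (- a\<^sup>2 / 2)"
    by (simp add: char_std_normal_distribution)
qed

text \<open>
  The linear combination is rescaled to unit variance, and the scale moved into the argument of
  the characteristic function; a combination of variance zero vanishes almost surely.
\<close>

lemma white_noise_char:
  assumes noise: "white_noise M V \<Xi>" and J: "finite J" "J \<subseteq> V"
  shows "(CLINT \<omega>|M. iexp (\<Sum>\<phi>\<in>J. t \<phi> * \<Xi> \<phi> \<omega>)) = exp (- (norm (\<Sum>\<phi>\<in>J. t \<phi> *\<^sub>R \<phi>))\<^sup>2 / 2)"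
proof -
  define \<sigma> where "\<sigma> = norm (\<Sum>\<phi>\<in>J. t \<phi> *\<^sub>R \<phi>)"
  have meas[measurable]: "\<Xi> \<phi> \<in> borel_measurable M" if "\<phi> \<in> J" for \<phi>
    using noise that J by (auto simp: white_noise_def)
  have law: "distr M borel (\<lambda>\<omega>. \<Sum>\<phi>\<in>J. a \<phi> * \<Xi> \<phi> \<omega>) = gaussian 0 (norm (\<Sum>\<phi>\<in>J. a \<phi> *\<^sub>R \<phi>))" for a
    using noise J by (auto simp: white_noise_def)
  have char_law: "(CLINT x|distr M borel (\<lambda>\<omega>. \<Sum>\<phi>\<in>J. a \<phi> * \<Xi> \<phi> \<omega>). iexp (r * x))
      = (CLINT \<omega>|M. iexp (r * (\<Sum>\<phi>\<in>J. a \<phi> * \<Xi> \<phi> \<omega>)))" for a r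
    by (subst integral_distr) auto
  show ?thesis
  proof (cases "\<sigma> = 0")
    case True
    then show ?thesis
      using char_law[where r=1 and a=t] law[of t]
      by (simp add: gaussian_def \<sigma>_def integral_return)
  next
    case False
    define a where "a \<phi> = t \<phi> / \<sigma>" for \<phi>
    have "(\<Sum>\<phi>\<in>J. a \<phi> *\<^sub>R \<phi>) = (1 / \<sigma>) *\<^sub>R (\<Sum>\<phi>\<in>J. t \<phi> *\<^sub>R \<phi>)"
      by (simp add: a_def scaleR_sum_right)
    then have "norm (\<Sum>\<phi>\<in>J. a \<phi> *\<^sub>R \<phi>) = 1"
      using False by (simp add: \<sigma>_def)
    then have "distr M borel (\<lambda>\<omega>. \<Sum>\<phi>\<in>J. a \<phi> * \<Xi> \<phi> \<omega>) = std_normal_distribution"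
      using law[of a] by (simp add: gaussian_def)
    moreover have "\<sigma> * (\<Sum>\<phi>\<in>J. a \<phi> * \<Xi> \<phi> \<omega>) = (\<Sum>\<phi>\<in>J. t \<phi> * \<Xi> \<phi> \<omega>)" for \<omega>
      using False by (simp add: a_def sum_distrib_left)
    ultimately have "(CLINT \<omega>|M. iexp (\<Sum>\<phi>\<in>J. t \<phi> * \<Xi> \<phi> \<omega>)) = char std_normal_distribution \<sigma>"
      using char_law[where r=\<sigma> and a=a] by (simp add: char_def)
    then show ?thesis by (simp add: char_std_normal_distribution \<sigma>_def)
  qed
qed

text \<open>
  The test element \<open>w\<close> may itself belong to \<open>J\<close>, in which case its two coefficients add up.
\<close>

lemma white_noise_char_insert:
  assumes noise: "white_noise M V \<Xi>" and w: "w \<in> V" and J: "finite J" "J \<subseteq> V"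
  shows "(CLINT \<omega>|M. iexp (r * \<Xi> w \<omega> + s * (\<Sum>\<phi>\<in>J. t \<phi> * \<Xi> \<phi> \<omega>)))
    = exp (- (norm (r *\<^sub>R w + s *\<^sub>R (\<Sum>\<phi>\<in>J. t \<phi> *\<^sub>R \<phi>)))\<^sup>2 / 2)"
proof -
  define a where "a \<phi> = (if \<phi> = w then r else 0) + (if \<phi> \<in> J then s * t \<phi> else 0)" for \<phi>
  have eq: "insert w J \<inter> J = J" "insert w J \<inter> {w} = {w}" by auto
  have "(\<Sum>\<phi>\<in>insert w J. a \<phi> * c \<phi>) = r * c w + s * (\<Sum>\<phi>\<in>J. t \<phi> * c \<phi>)" for c :: "_ \<Rightarrow> real"
    using J(1)
    by (simp add: a_def distrib_right sum.distrib if_distrib[of "\<lambda>x. x * _"] sum_distrib_left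
        mult.assoc eq flip: sum.inter_restrict cong: if_cong del: sum.insert)
  moreover have "(\<Sum>\<phi>\<in>insert w J. a \<phi> *\<^sub>R \<phi>) = r *\<^sub>R w + s *\<^sub>R (\<Sum>\<phi>\<in>J. t \<phi> *\<^sub>R \<phi>)"
    using J(1)
    by (simp add: a_def scaleR_add_left sum.distrib if_distrib[of "\<lambda>x. x *\<^sub>R _"] scaleR_sum_right
        eq flip: sum.inter_restrict cong: if_cong del: sum.insert)
  ultimately show ?thesis
    using white_noise_char[OF noise, of "insert w J" a] w J by simp
qed

lemma iexp_add: "iexp (x + y) = iexp x * iexp y"
  by (simp add: ring_distribs exp_add)

lemma exp_half_squares: "exp (- x\<^sup>2 / 2) * exp (- y\<^sup>2 / 2) = exp (- (x\<^sup>2 + y\<^sup>2) / 2)" for x y :: real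
  by (simp add: mult_exp_exp add_divide_distrib diff_divide_distrib)

text \<open>
  Orthogonal decomposition: write \<open>\<psi> t = a w + \<psi>'\<close> with \<open>\<psi>'\<close> orthogonal to \<open>w\<close>. The joint
  characteristic function of \<open>\<Xi> w\<close> and \<open>\<Sum>\<phi>\<in>J. t \<phi> * \<Xi> \<phi>\<close> is the one of \<open>\<sigma> x\<close> and
  \<open>a \<sigma> x + \<rho> y\<close> for independent standard normal \<open>x, y\<close>, with \<open>\<sigma> = \<parallel>w\<parallel>\<close> and \<open>\<rho> = \<parallel>\<psi>'\<parallel>\<close>.
  Hence the expectation may be computed for the latter pair, where it factorises.
\<close>

lemma white_noise_exponential_tilt:
  fixes c :: real
  assumes noise: "white_noise M V \<Xi>" and w: "w \<in> V" and J: "finite J" "J \<subseteq> V"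
  defines "\<psi> \<equiv> \<lambda>t. \<Sum>\<phi>\<in>J. t \<phi> *\<^sub>R \<phi>"
  shows "integrable M (\<lambda>\<omega>. exp (c * \<Xi> w \<omega>))"
    and "(CLINT \<omega>|M. exp (c * \<Xi> w \<omega>) * iexp (\<Sum>\<phi>\<in>J. t \<phi> * \<Xi> \<phi> \<omega>))
      = exp (c\<^sup>2 * (norm w)\<^sup>2 / 2) * iexp (c * inner w (\<psi> t)) * exp (- (norm (\<psi> t))\<^sup>2 / 2)"
proof -
  define \<sigma> where "\<sigma> = norm w"
  \<comment> \<open>If \<open>w = 0\<close>, then division by zero gives \<open>a = 0\<close>, so that \<open>a * \<sigma>\<^sup>2 = inner w (\<psi> t)\<close> holds in every case.\<close>
  define a where "a = inner w (\<psi> t) / \<sigma>\<^sup>2"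
  define \<rho> where "\<rho> = sqrt ((norm (\<psi> t))\<^sup>2 - a\<^sup>2 * \<sigma>\<^sup>2)"
  have \<sigma>: "\<sigma>\<^sup>2 = inner w w" by (simp add: \<sigma>_def power2_norm_eq_inner)
  have a: "a * \<sigma>\<^sup>2 = inner w (\<psi> t)"
    by (cases "w = 0") (auto simp: a_def \<sigma>_def)
  have "a\<^sup>2 * \<sigma>\<^sup>2 \<le> (norm (\<psi> t))\<^sup>2"
  proof (cases "\<sigma> = 0")
    case False
    have "(a\<^sup>2 * \<sigma>\<^sup>2) * \<sigma>\<^sup>2 = (inner w (\<psi> t))\<^sup>2"
      using a by (simp add: power2_eq_square mult_ac flip: a)
    also have "\<dots> \<le> (norm (\<psi> t))\<^sup>2 * \<sigma>\<^sup>2"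
      using Cauchy_Schwarz_ineq[of w "\<psi> t"] by (simp add: power2_norm_eq_inner \<sigma> mult.commute)
    finally show ?thesis using False by simp
  qed simp
  then have \<rho>: "\<rho>\<^sup>2 = (norm (\<psi> t))\<^sup>2 - a\<^sup>2 * \<sigma>\<^sup>2"
    by (simp add: \<rho>_def)
  have prob: "prob_space M" and [measurable]: "\<Xi> w \<in> borel_measurable M"
    and [measurable]: "\<And>\<phi>. \<phi> \<in> J \<Longrightarrow> \<Xi> \<phi> \<in> borel_measurable M"
    using noise w J by (auto simp: white_noise_def)
  interpret M: prob_space M by fact
  interpret S: prob_space std_normal_distribution by (rule prob_space_normal_density) simp
  interpret SS: pair_prob_space std_normal_distribution std_normal_distribution ..
  let ?S2 = "std_normal_distribution \<Otimes>\<^sub>M std_normal_distribution"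
  have int_iexp: "integrable std_normal_distribution (\<lambda>x. iexp (r * x))" for r
    by (rule integrable_iexp) (auto simp: S.finite_measure_axioms)
  have int_exp: "integrable M (\<lambda>\<omega>. exp (c * \<Xi> w \<omega>))" for c
  proof -
    have "distr M borel (\<Xi> w) = distr std_normal_distribution borel (\<lambda>x. \<sigma> * x)"
    proof (rule finite_measure_eqI_char)
      fix r
      have "char (distr M borel (\<Xi> w)) r = exp (- (norm (r *\<^sub>R w))\<^sup>2 / 2)"
        using white_noise_char_insert[OF noise w, of "{}" r 0]
        by (simp add: char_def integral_distr)
      also have "\<dots> = char std_normal_distribution (r * \<sigma>)"
        by (simp add: char_std_normal_distribution \<sigma>_def power_mult_distrib)
      also have "\<dots> = char (distr std_normal_distribution borel (\<lambda>x. \<sigma> * x)) r"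
        by (simp add: char_def integral_distr mult.assoc)
      finally show "char (distr M borel (\<Xi> w)) r = char (distr std_normal_distribution borel (\<lambda>x. \<sigma> * x)) r" .
    qed (auto intro!: M.finite_measure_distr S.finite_measure_distr)
    moreover have "integrable (distr std_normal_distribution borel (\<lambda>x. \<sigma> * x)) (\<lambda>x. exp (c * x))"
      using std_normal_exponential_tilt(1)[of "c * \<sigma>"] by (simp add: integrable_distr_eq mult.assoc)
    ultimately show ?thesis
      using integrable_distr[of "\<Xi> w" M borel "\<lambda>x. exp (c * x)"] by simp
  qed
  then show "integrable M (\<lambda>\<omega>. exp (c * \<Xi> w \<omega>))" .
  have "(CLINT \<omega>|M. exp (c * \<Xi> w \<omega>) * iexp (\<Sum>\<phi>\<in>J. t \<phi> * \<Xi> \<phi> \<omega>))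
    = (CLINT z|?S2. exp (c * (\<sigma> * fst z)) * iexp (a * \<sigma> * fst z + \<rho> * snd z))"
  proof (rule integral_weighted_iexp_eq[where f="\<lambda>x. exp (c * x)" and ?X1.0="\<Xi> w" and ?X2.0="\<lambda>z. \<sigma> * fst z"])
    fix s r
    have "r * (\<sigma> * x) + s * (a * \<sigma> * x + \<rho> * y) = (r + s * a) * \<sigma> * x + s * \<rho> * y" for x y
      by (simp add: algebra_simps)
    then have "(CLINT z|?S2. iexp (r * (\<sigma> * fst z) + s * (a * \<sigma> * fst z + \<rho> * snd z)))
      = (CLINT z|?S2. iexp ((r + s * a) * \<sigma> * fst z) * iexp (s * \<rho> * snd z))"
      by (simp only: iexp_add)
    also have "\<dots> = char std_normal_distribution ((r + s * a) * \<sigma>) * char std_normal_distribution (s * \<rho>)"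
      unfolding char_def by (intro integral_pair_measure_mult SS.pair_sigma_finite_axioms int_iexp)
    also have "\<dots> = exp (- (((r + s * a) * \<sigma>)\<^sup>2 + (s * \<rho>)\<^sup>2) / 2)"
      by (simp only: char_std_normal_distribution exp_half_squares flip: of_real_mult)
    also have "((r + s * a) * \<sigma>)\<^sup>2 + (s * \<rho>)\<^sup>2 = (norm (r *\<^sub>R w + s *\<^sub>R \<psi> t))\<^sup>2"
    proof -
      have "((r + s * a) * \<sigma>)\<^sup>2 + (s * \<rho>)\<^sup>2 = r\<^sup>2 * \<sigma>\<^sup>2 + 2 * r * s * (a * \<sigma>\<^sup>2) + s\<^sup>2 * (norm (\<psi> t))\<^sup>2"
        unfolding power_mult_distrib \<rho> by (simp add: power2_eq_square algebra_simps)
      also have "\<dots> = (norm (r *\<^sub>R w + s *\<^sub>R \<psi> t))\<^sup>2"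
        unfolding a unfolding \<sigma> power2_norm_eq_inner
        by (simp add: inner_add inner_commute power2_eq_square algebra_simps)
      finally show ?thesis .
    qed
    finally show "(CLINT \<omega>|M. iexp (r * \<Xi> w \<omega> + s * (\<Sum>\<phi>\<in>J. t \<phi> * \<Xi> \<phi> \<omega>)))
      = (CLINT z|?S2. iexp (r * (\<sigma> * fst z) + s * (a * \<sigma> * fst z + \<rho> * snd z)))"
      using white_noise_char_insert[OF noise w J] by (simp add: \<psi>_def)
  next
    have "integrable (distr ?S2 std_normal_distribution fst) (\<lambda>x. exp (c * \<sigma> * x))"
      unfolding S.distr_pair_fst by (rule std_normal_exponential_tilt(1))
    then show "integrable ?S2 (\<lambda>z. exp (c * (\<sigma> * fst z)))"
      by (subst (asm) integrable_distr_eq) (auto simp: mult.assoc)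
  qed (auto simp: int_exp M.finite_measure_axioms SS.finite_measure_axioms)
  also have "\<dots> = (CLINT z|?S2. (exp (c * \<sigma> * fst z) * iexp (a * \<sigma> * fst z)) * iexp (\<rho> * snd z))"
    by (simp only: iexp_add mult.assoc)
  also have "\<dots> = (CLINT x|std_normal_distribution. exp (c * \<sigma> * x) * iexp (a * \<sigma> * x))
      * (CLINT y|std_normal_distribution. iexp (\<rho> * y))"
  proof (rule integral_pair_measure_mult)
    show "integrable std_normal_distribution (\<lambda>x. complex_of_real (exp (c * \<sigma> * x)) * iexp (a * \<sigma> * x))"
      using std_normal_exponential_tilt(1)[of "c * \<sigma>"]
      by (rule Bochner_Integration.integrable_bound) (auto simp: norm_mult)
  qed (rule SS.pair_sigma_finite_axioms int_iexp)+
  also have "\<dots> = exp ((c * \<sigma>)\<^sup>2 / 2) * iexp (a * \<sigma> * (c * \<sigma>)) * exp (- (a * \<sigma>)\<^sup>2 / 2) * exp (- \<rho>\<^sup>2 / 2)"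
    unfolding std_normal_exponential_tilt(2)
    using char_std_normal_distribution by (simp add: char_def fun_eq_iff)
  also have "a * \<sigma> * (c * \<sigma>) = c * inner w (\<psi> t)"
    by (simp add: power2_eq_square mult_ac flip: a)
  also have "exp ((c * \<sigma>)\<^sup>2 / 2) * iexp (c * inner w (\<psi> t)) * exp (- (a * \<sigma>)\<^sup>2 / 2) * exp (- \<rho>\<^sup>2 / 2)
    = exp (c\<^sup>2 * (norm w)\<^sup>2 / 2) * iexp (c * inner w (\<psi> t)) * exp (- (norm (\<psi> t))\<^sup>2 / 2)"
  proof -
    have "exp (- (a * \<sigma>)\<^sup>2 / 2) * exp (- \<rho>\<^sup>2 / 2) = exp (- (norm (\<psi> t))\<^sup>2 / 2)"
      unfolding exp_half_squares by (simp add: \<rho> power_mult_distrib)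
    then show ?thesis
      by (simp add: \<sigma>_def power_mult_distrib mult.assoc flip: of_real_mult)
  qed
  finally show "(CLINT \<omega>|M. exp (c * \<Xi> w \<omega>) * iexp (\<Sum>\<phi>\<in>J. t \<phi> * \<Xi> \<phi> \<omega>))
      = exp (c\<^sup>2 * (norm w)\<^sup>2 / 2) * iexp (c * inner w (\<psi> t)) * exp (- (norm (\<psi> t))\<^sup>2 / 2)" .
qed

section \<open>Mutual absolute continuity of the laws of the data\<close>

lemma measurable_observation:
  assumes "\<And>\<phi>. \<phi> \<in> V \<Longrightarrow> \<Xi> \<phi> \<in> borel_measurable M"
  shows "observation V \<Xi> n w \<in> M \<rightarrow>\<^sub>M data_space V"
  unfolding observation_def data_space_def using assms by (intro measurable_restrict) auto

lemma emeasure_observation_cylinder: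
  assumes \<Xi>: "\<And>\<phi>. \<phi> \<in> V \<Longrightarrow> \<Xi> \<phi> \<in> borel_measurable M"
    and J: "finite J" "J \<subseteq> V" and A: "\<And>j. j \<in> J \<Longrightarrow> A j \<in> sets borel"
  shows "emeasure (distr M (data_space V) (observation V \<Xi> n w)) (prod_emb V (\<lambda>_. borel) J (Pi\<^sub>E J A))
    = emeasure M {\<omega> \<in> space M. \<forall>j\<in>J. inner w j + \<Xi> j \<omega> / sqrt (real n) \<in> A j}"
proof -
  have "prod_emb V (\<lambda>_. borel) J (Pi\<^sub>E J A) \<in> sets (data_space V)"
    unfolding data_space_def using J A by (intro sets_PiM_I) auto
  moreover have "observation V \<Xi> n w -` prod_emb V (\<lambda>_. borel) J (Pi\<^sub>E J A) \<inter> space M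
      = {\<omega> \<in> space M. \<forall>j\<in>J. inner w j + \<Xi> j \<omega> / sqrt (real n) \<in> A j}"
    using J by (auto simp: prod_emb_def observation_def PiE_iff subset_eq)
  ultimately show ?thesis
    by (simp add: emeasure_distr measurable_observation[OF \<Xi>])
qed

text \<open>
  The Cameron-Martin theorem for the white noise model. With \<open>c = sqrt n\<close>, weighting the noise
  with \<open>exp (c * \<Xi> w - c\<^sup>2 * \<parallel>w\<parallel>\<^sup>2 / 2)\<close> multiplies the characteristic function
  of \<open>\<Sum>j\<in>J. t j * \<Xi> j / c\<close> by \<open>iexp (\<Sum>j\<in>J. t j * inner w j)\<close>, which is also the effect of adding the
  signal \<open>w\<close>. In terms of the data \<open>y = \<Xi> / c\<close> of the zero signal, the exponent is
  \<open>n * y w - n * \<parallel>w\<parallel>\<^sup>2 / 2\<close>.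
\<close>

lemma data_law_eq_density:
  assumes noise: "white_noise M V \<Xi>" and w: "w \<in> V" and n: "n \<ge> 1"
  shows "data_law M V \<Xi> n w
    = density (data_law M V \<Xi> n 0) (\<lambda>y. ennreal (exp (real n * y w - real n * (norm w)\<^sup>2 / 2)))"
proof -
  have prob: "prob_space M" and \<Xi>[measurable]: "\<And>\<phi>. \<phi> \<in> V \<Longrightarrow> \<Xi> \<phi> \<in> borel_measurable M"
    using noise by (auto simp: white_noise_def)
  interpret M: prob_space M by fact
  have [measurable]: "\<Xi> w \<in> borel_measurable M" using w by (rule \<Xi>)
  have w_meas: "(\<lambda>y. y w) \<in> borel_measurable (data_space V)"
    unfolding data_space_def using w by (rule measurable_component_singleton)
  define c where "c = sqrt (real n)"
  have c: "c\<^sup>2 = real n" "c > 0" using n by (auto simp: c_def)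
  define q where "q \<omega> = exp (c * \<Xi> w \<omega>) * exp (- (c\<^sup>2 * (norm w)\<^sup>2 / 2))" for \<omega>
  have [measurable]: "q \<in> borel_measurable M" unfolding q_def by measurable
  have q_nonneg: "0 \<le> q \<omega>" for \<omega> by (simp add: q_def)
  define Q where "Q = density M (\<lambda>\<omega>. ennreal (q \<omega>))"
  have q_int: "integrable M q"
    unfolding q_def using white_noise_exponential_tilt(1)[OF noise w, of "{}"] by simp
  then have fin_Q: "finite_measure Q"
    unfolding Q_def
    by (intro finite_measureI)
       (auto simp: emeasure_density nn_integral_eq_integral q_nonneg cong: nn_integral_cong_simp)
  have \<Xi>Q: "\<Xi> \<phi> \<in> borel_measurable Q" if "\<phi> \<in> V" for \<phi>
    using \<Xi>[OF that] by (simp add: Q_def)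
  have "data_law M V \<Xi> n w = distr Q (data_space V) (observation V \<Xi> n 0)"
  proof (rule measure_eqI_PiM_infinite[where I=V and M="\<lambda>_. borel"])
    fix J and A :: "'b \<Rightarrow> real set"
    assume J: "finite J" "J \<subseteq> V" and A: "\<And>j. j \<in> J \<Longrightarrow> A j \<in> sets borel"
    have "measure M {\<omega> \<in> space M. \<forall>j\<in>J. inner w j + \<Xi> j \<omega> / c \<in> A j}
        = measure Q {\<omega> \<in> space Q. \<forall>j\<in>J. inner 0 j + \<Xi> j \<omega> / c \<in> A j}"
    proof (rule measure_cylinder_eq)
      fix t :: "'b \<Rightarrow> real"
      define \<psi> where "\<psi> = (\<Sum>j\<in>J. (t j / c) *\<^sub>R j)"
      define N where "N = exp (- (norm \<psi>)\<^sup>2 / 2)"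
      have shift: "(\<Sum>j\<in>J. t j * inner w j) = c * inner w \<psi>"
        using c by (simp add: \<psi>_def inner_sum_right sum_distrib_left)
      have "(CLINT \<omega>|M. iexp (\<Sum>j\<in>J. t j * (inner w j + \<Xi> j \<omega> / c)))
          = (CLINT \<omega>|M. iexp (c * inner w \<psi>) * iexp (\<Sum>j\<in>J. t j / c * \<Xi> j \<omega>))"
        by (simp only: ring_distribs sum.distrib shift iexp_add times_divide_eq_left times_divide_eq_right)
      also have "\<dots> = iexp (c * inner w \<psi>) * N"
        unfolding integral_mult_right_zero white_noise_char[OF noise J] N_def \<psi>_def ..
      also have "\<dots> = exp (- (c\<^sup>2 * (norm w)\<^sup>2 / 2))
          * (exp (c\<^sup>2 * (norm w)\<^sup>2 / 2) * iexp (c * inner w \<psi>) * N)"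
        by (simp add: exp_minus)
      also have "\<dots> = (CLINT \<omega>|M. exp (- (c\<^sup>2 * (norm w)\<^sup>2 / 2))
          * (exp (c * \<Xi> w \<omega>) * iexp (\<Sum>j\<in>J. t j / c * \<Xi> j \<omega>)))"
        unfolding integral_mult_right_zero white_noise_exponential_tilt(2)[OF noise w J] N_def \<psi>_def ..
      also have "\<dots> = (CLINT \<omega>|M. q \<omega> *\<^sub>R iexp (\<Sum>j\<in>J. t j * (inner 0 j + \<Xi> j \<omega> / c)))"
        by (simp add: q_def scaleR_conv_of_real mult_ac)
      also have "\<dots> = (CLINT \<omega>|Q. iexp (\<Sum>j\<in>J. t j * (inner 0 j + \<Xi> j \<omega> / c)))"
        unfolding Q_def using J by (subst integral_density) (auto simp: q_nonneg \<Xi> subset_eq)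
      finally show "(CLINT \<omega>|M. iexp (\<Sum>j\<in>J. t j * (inner w j + \<Xi> j \<omega> / c)))
          = (CLINT \<omega>|Q. iexp (\<Sum>j\<in>J. t j * (inner 0 j + \<Xi> j \<omega> / c)))" .
    qed (use J A fin_Q \<Xi>Q \<Xi> M.finite_measure_axioms in auto)
    then show "emeasure (data_law M V \<Xi> n w) (prod_emb V (\<lambda>_. borel) J (Pi\<^sub>E J A))
        = emeasure (distr Q (data_space V) (observation V \<Xi> n 0)) (prod_emb V (\<lambda>_. borel) J (Pi\<^sub>E J A))"
      unfolding data_law_def
      by (simp add: emeasure_observation_cylinder[OF \<Xi> J A] emeasure_observation_cylinder[OF \<Xi>Q J A]
          M.emeasure_eq_measure finite_measure.emeasure_eq_measure[OF fin_Q] c_def)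
  next
    show "finite_measure (data_law M V \<Xi> n w)"
      unfolding data_law_def by (intro M.finite_measure_distr measurable_observation \<Xi>)
  qed (auto simp: data_law_def data_space_def)
  also have "Q = density M (\<lambda>\<omega>. ennreal (exp (real n * observation V \<Xi> n 0 \<omega> w - real n * (norm w)\<^sup>2 / 2)))"
  proof -
    have "real n * (x / c) = c * x" for x
      using c by (simp add: power2_eq_square flip: c(1))
    then show ?thesis
      using w by (simp add: Q_def q_def observation_def c(1) mult_exp_exp flip: c_def)
  qed
  also have "distr \<dots> (data_space V) (observation V \<Xi> n 0)
      = density (data_law M V \<Xi> n 0) (\<lambda>y. ennreal (exp (real n * y w - real n * (norm w)\<^sup>2 / 2)))"
    unfolding data_law_def
    by (intro density_distr[symmetric] measurable_observation \<Xi>) (use w_meas in simp_all)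
  finally show ?thesis .
qed

text \<open>
  The Cameron-Martin density is strictly positive, so every law of the data has the null sets of the
  law of pure noise.
\<close>

lemma AE_data_law_transfer:
  assumes noise: "white_noise M V \<Xi>" and n: "n \<ge> 1" and w: "w \<in> V" "w' \<in> V"
    and AE: "AE y in data_law M V \<Xi> n w. Q y"
  shows "AE y in data_law M V \<Xi> n w'. Q y"
proof -
  have "(AE y in data_law M V \<Xi> n v. Q y) \<longleftrightarrow> (AE y in data_law M V \<Xi> n 0. Q y)" if v: "v \<in> V" for v
  proof -
    have "(\<lambda>y. y v) \<in> borel_measurable (data_space V)"
      unfolding data_space_def using v by (rule measurable_component_singleton)
    then have [measurable]: "(\<lambda>y. y v) \<in> borel_measurable (data_law M V \<Xi> n 0)"
      by (simp add: data_law_def)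
    show ?thesis
      unfolding data_law_eq_density[OF noise v n] by (subst AE_density) auto
  qed
  then show ?thesis using AE w by blast
qed

lemma measurable_data_minus: "(\<lambda>y. data_minus V y w) \<in> data_space V \<rightarrow>\<^sub>M data_space V"
  unfolding data_minus_def data_space_def
  by (intro measurable_restrict borel_measurable_diff measurable_component_singleton) auto

lemma data_minus_uminus: "y \<in> space (data_space V) \<Longrightarrow> data_minus V (data_minus V y w) (- w) = y"
  by (auto simp: data_minus_def data_space_def space_PiM fun_eq_iff PiE_iff extensional_def)

lemma data_minus_observation:
  "data_minus V (observation V \<Xi> n (w + w') \<omega>) w' = observation V \<Xi> n w \<omega>"
  by (auto simp: data_minus_def observation_def inner_add_left intro!: restrict_ext)

lemma measurable_observation_pair:
  assumes \<Xi>: "\<And>\<phi>. \<phi> \<in> V \<Longrightarrow> \<Xi> \<phi> \<in> borel_measurable M"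
    and B: "B \<in> borel_measurable P"
  shows "(\<lambda>(\<theta>, \<omega>). observation V \<Xi> n (B \<theta>) \<omega>) \<in> P \<Otimes>\<^sub>M M \<rightarrow>\<^sub>M data_space V"
  unfolding case_prod_beta' observation_def data_space_def
proof (rule measurable_restrict)
  fix \<phi> assume "\<phi> \<in> V"
  note [measurable] = \<Xi>[OF this]
  have "(\<lambda>w. inner w \<phi>) \<in> borel_measurable borel"
    by (intro borel_measurable_continuous_onI continuous_intros)
  from measurable_compose[OF B this] have [measurable]: "(\<lambda>\<theta>. inner (B \<theta>) \<phi>) \<in> borel_measurable P" .
  show "(\<lambda>z. inner (B (fst z)) \<phi> + \<Xi> \<phi> (snd z) / sqrt (real n)) \<in> borel_measurable (P \<Otimes>\<^sub>M M)"
    by measurable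
qed

text \<open>
  The marginal law is the mixture of the laws of the data. By Fubini, one of its null sets is
  a null set for some parameter, and thus for every signal in \<open>V\<close>, even for one that the
  prior does not charge.
\<close>

lemma AE_data_law_of_AE_marginal:
  assumes noise: "white_noise M V \<Xi>" and n: "n \<ge> 1" and P: "prob_space P"
    and B: "B \<in> borel_measurable P" "\<And>\<theta>. \<theta> \<in> space P \<Longrightarrow> B \<theta> \<in> V"
    and AE: "AE y in distr (P \<Otimes>\<^sub>M M) (data_space V) (\<lambda>(\<theta>, \<omega>). observation V \<Xi> n (B \<theta>) \<omega>). Q y"
    and w: "w \<in> V"
  shows "AE y in data_law M V \<Xi> n w. Q y"
proof -
  have M: "prob_space M" and \<Xi>: "\<And>\<phi>. \<phi> \<in> V \<Longrightarrow> \<Xi> \<phi> \<in> borel_measurable M"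
    using noise by (auto simp: white_noise_def)
  interpret P: prob_space P by (rule P)
  interpret M: prob_space M by (rule M)
  interpret PM: pair_prob_space P M ..
  let ?X = "\<lambda>(\<theta>, \<omega>). observation V \<Xi> n (B \<theta>) \<omega>"
  have X: "?X \<in> P \<Otimes>\<^sub>M M \<rightarrow>\<^sub>M data_space V"
    by (rule measurable_observation_pair[OF \<Xi> B(1)])
  obtain N where N: "N \<in> null_sets (distr (P \<Otimes>\<^sub>M M) (data_space V) ?X)"
    "{y \<in> space (data_space V). \<not> Q y} \<subseteq> N"
    using AE by (auto elim!: AE_E simp: null_sets_def)
  have N_sets: "N \<in> sets (data_space V)" using N(1) by auto
  have "AE z in P \<Otimes>\<^sub>M M. ?X z \<notin> N"
    by (rule AE_distrD[OF X AE_not_in[OF N(1)]])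
  from PM.AE_pair[OF this] have "AE \<theta> in P. AE \<omega> in M. observation V \<Xi> n (B \<theta>) \<omega> \<notin> N"
    by simp
  then have "\<exists>\<theta>\<in>space P. AE \<omega> in M. observation V \<Xi> n (B \<theta>) \<omega> \<notin> N"
    using P.AE_contr AE_space by (metis (no_types, lifting) AE_mp P.AE_False AE_I2)
  then obtain \<theta> where \<theta>: "\<theta> \<in> space P" "AE \<omega> in M. observation V \<Xi> n (B \<theta>) \<omega> \<notin> N" by blast
  then have "AE y in data_law M V \<Xi> n (B \<theta>). y \<notin> N"
    unfolding data_law_def
    by (subst AE_distr_iff[OF measurable_observation[OF \<Xi>]]) (use N_sets in auto)
  from AE_data_law_transfer[OF noise n B(2)[OF \<theta>(1)] w this]
  show ?thesis
    using AE_space by eventually_elim (use N(2) in \<open>auto simp: data_law_def\<close>)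
qed

section \<open>Posterior mass under a change of variables\<close>

text \<open>
  The defining property of the posterior concerns rectangles only. It extends to all
  measurable sets in the product because both sides are finite measures in \<open>S\<close>.
  This gives access to data-dependent credible sets, whose graphs are not rectangles.
\<close>

lemma posterior_disintegration:
  assumes post: "posterior M Y X P \<kappa>" and P: "prob_space P" and M: "prob_space M"
    and X[measurable]: "(\<lambda>(\<theta>, \<omega>). X \<theta> \<omega>) \<in> P \<Otimes>\<^sub>M M \<rightarrow>\<^sub>M Y"
    and S: "S \<in> sets (Y \<Otimes>\<^sub>M P)"
  shows "emeasure (P \<Otimes>\<^sub>M M) {(\<theta>, \<omega>) \<in> space (P \<Otimes>\<^sub>M M). (X \<theta> \<omega>, \<theta>) \<in> S}
    = (\<integral>\<^sup>+y. emeasure (\<kappa> y) (Pair y -` S) \<partial>distr (P \<Otimes>\<^sub>M M) Y (\<lambda>(\<theta>, \<omega>). X \<theta> \<omega>))"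
proof -
  interpret P: prob_space P by fact
  interpret M: prob_space M by fact
  interpret PM: pair_prob_space P M ..
  let ?m = "distr (P \<Otimes>\<^sub>M M) Y (\<lambda>(\<theta>, \<omega>). X \<theta> \<omega>)"
  let ?g = "\<lambda>(\<theta>, \<omega>). (X \<theta> \<omega>, \<theta>)"
  have \<kappa>[measurable]: "\<kappa> \<in> Y \<rightarrow>\<^sub>M prob_algebra P"
    using post by (simp add: posterior_def)
  then have \<kappa>_sub: "\<kappa> \<in> ?m \<rightarrow>\<^sub>M subprob_algebra P"
    by (simp add: measurable_prob_algebraD)
  have \<kappa>_prob: "prob_space (\<kappa> y)" "sets (\<kappa> y) = sets P" if "y \<in> space Y" for y
    using measurable_space[OF \<kappa> that] by (auto simp: space_prob_algebra)
  have \<kappa>_section: "Pair y -` S \<in> sets (\<kappa> y)" if "S \<in> sets (Y \<Otimes>\<^sub>M P)" "y \<in> space Y" for S y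
    using sets_Pair1[OF that(1)] \<kappa>_prob(2)[OF that(2)] by simp
  have kernel_meas: "(\<lambda>y. emeasure (\<kappa> y) (Pair y -` S)) \<in> borel_measurable ?m"
    if "S \<in> sets (Y \<Otimes>\<^sub>M P)" for S
  proof (rule emeasure_measurable_subprob_algebra2[OF _ \<kappa>_sub])
    have "(SIGMA y:space ?m. Pair y -` S) = S"
      using sets.sets_into_space[OF that] by (auto simp: space_pair_measure)
    then show "(SIGMA y:space ?m. Pair y -` S) \<in> sets (?m \<Otimes>\<^sub>M P)"
      using that by (simp cong: sets_pair_measure_cong)
  qed
  have g[measurable]: "?g \<in> P \<Otimes>\<^sub>M M \<rightarrow>\<^sub>M Y \<Otimes>\<^sub>M P"
    using X by (simp add: case_prod_beta')
  let ?joint = "distr (P \<Otimes>\<^sub>M M) (Y \<Otimes>\<^sub>M P) ?g"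
  interpret joint: prob_space ?joint by (rule PM.prob_space_distr[OF g])
  interpret marginal: prob_space ?m by (rule PM.prob_space_distr[OF X])
  have event: "{(\<theta>, \<omega>) \<in> space (P \<Otimes>\<^sub>M M). (X \<theta> \<omega>, \<theta>) \<in> S} = ?g -` S \<inter> space (P \<Otimes>\<^sub>M M)" for S
    by auto
  have "emeasure ?joint S = (\<integral>\<^sup>+y. emeasure (\<kappa> y) (Pair y -` S) \<partial>?m)"
    using S[unfolded sets_pair_measure]
  proof (induction S rule: sigma_sets_induct_disjoint[OF Int_stable_pair_measure_generator pair_measure_closed, consumes 1, case_names basic empty compl union])
    case (basic S)
    then obtain B A where S: "S = B \<times> A" and BA: "B \<in> sets Y" "A \<in> sets P" by auto
    have "emeasure ?joint S
        = emeasure (P \<Otimes>\<^sub>M M) {(\<theta>, \<omega>) \<in> space (P \<Otimes>\<^sub>M M). \<theta> \<in> A \<and> X \<theta> \<omega> \<in> B}"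
      using BA by (subst emeasure_distr) (auto simp: S intro!: arg_cong[where f="emeasure _"])
    also have "\<dots> = (\<integral>\<^sup>+y\<in>B. emeasure (\<kappa> y) A \<partial>?m)"
      using post BA by (simp add: posterior_def)
    also have "\<dots> = (\<integral>\<^sup>+y. emeasure (\<kappa> y) (Pair y -` S) \<partial>?m)"
      by (intro nn_integral_cong) (auto simp: S split: split_indicator)
    finally show ?case .
  next
    case empty
    then show ?case by simp
  next
    case (compl S)
    then have S: "S \<in> sets (Y \<Otimes>\<^sub>M P)" by (simp add: sets_pair_measure)
    have "(\<integral>\<^sup>+y. emeasure (\<kappa> y) (Pair y -` (space Y \<times> space P - S)) \<partial>?m)
        = (\<integral>\<^sup>+y. 1 - emeasure (\<kappa> y) (Pair y -` S) \<partial>?m)"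
    proof (intro nn_integral_cong)
      fix y assume "y \<in> space ?m"
      then have y: "y \<in> space Y" by simp
      interpret K: prob_space "\<kappa> y" by (rule \<kappa>_prob[OF y])
      have "Pair y -` (space Y \<times> space P - S) = space (\<kappa> y) - Pair y -` S"
        using y sets_eq_imp_space_eq[OF \<kappa>_prob(2)[OF y]] by auto
      then show "emeasure (\<kappa> y) (Pair y -` (space Y \<times> space P - S)) = 1 - emeasure (\<kappa> y) (Pair y -` S)"
        using emeasure_compl[OF \<kappa>_section[OF S y]] K.emeasure_space_1 by simp
    qed
    also have "\<dots> = (\<integral>\<^sup>+y. 1 \<partial>?m) - (\<integral>\<^sup>+y. emeasure (\<kappa> y) (Pair y -` S) \<partial>?m)"
    proof (rule nn_integral_diff)
      show "(\<integral>\<^sup>+y. emeasure (\<kappa> y) (Pair y -` S) \<partial>?m) \<noteq> \<infinity>"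
        using joint.emeasure_finite[of S] unfolding compl.IH by simp
      show "AE y in ?m. emeasure (\<kappa> y) (Pair y -` S) \<le> 1"
        by (rule AE_I2) (simp add: prob_space.emeasure_le_1 \<kappa>_prob)
    qed (use kernel_meas[OF S] in auto)
    also have "(\<integral>\<^sup>+y. 1 \<partial>?m) = 1"
      using marginal.emeasure_space_1 by simp
    also have "1 - (\<integral>\<^sup>+y. emeasure (\<kappa> y) (Pair y -` S) \<partial>?m)
        = emeasure ?joint (space Y \<times> space P - S)"
      using emeasure_compl[of S ?joint] S joint.emeasure_space_1 unfolding compl.IH[symmetric]
      by (simp add: space_pair_measure)
    finally show ?case by simp
  next
    case (union S)
    then have S: "\<And>i. S i \<in> sets (Y \<Otimes>\<^sub>M P)" by (auto simp: sets_pair_measure)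
    have "(\<integral>\<^sup>+y. emeasure (\<kappa> y) (Pair y -` (\<Union>i. S i)) \<partial>?m)
        = (\<integral>\<^sup>+y. (\<Sum>i. emeasure (\<kappa> y) (Pair y -` S i)) \<partial>?m)"
    proof (intro nn_integral_cong)
      fix y assume "y \<in> space ?m"
      then have y: "y \<in> space Y" by simp
      have "disjoint_family (\<lambda>i. Pair y -` S i)"
        using union.hyps by (auto simp: disjoint_family_on_def)
      then show "emeasure (\<kappa> y) (Pair y -` (\<Union>i. S i)) = (\<Sum>i. emeasure (\<kappa> y) (Pair y -` S i))"
        using \<kappa>_section[OF S y] by (subst suminf_emeasure) (auto simp: vimage_UN)
    qed
    also have "\<dots> = (\<Sum>i. \<integral>\<^sup>+y. emeasure (\<kappa> y) (Pair y -` S i) \<partial>?m)"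
      by (intro nn_integral_suminf kernel_meas S)
    also have "\<dots> = (\<Sum>i. emeasure ?joint (S i))"
      using union.IH by simp
    also have "\<dots> = emeasure ?joint (\<Union>i. S i)"
      using S union.hyps by (intro suminf_emeasure) auto
    finally show ?case by simp
  qed
  then show ?thesis
    unfolding event using S by (simp add: emeasure_distr)
qed

text \<open>
  Both masses, integrated over an arbitrary measurable set \<open>E\<close> of data, are probabilities of
  joint events, and these events correspond to each other under \<open>(\<theta>, \<omega>) \<mapsto> (A \<theta>, \<omega>)\<close>. The left
  inverse \<open>T'\<close> makes every such \<open>E\<close> a preimage under \<open>T\<close>, as it must be in order to be transported to
  the second model.
\<close>

lemma AE_posterior_mass_eq:
  assumes post1: "posterior M Y X1 P1 \<kappa>1" and post2: "posterior M Y X2 P2 \<kappa>2"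
    and prob: "prob_space M" "prob_space P1" "prob_space P2"
    and X1[measurable]: "(\<lambda>(\<theta>, \<omega>). X1 \<theta> \<omega>) \<in> P1 \<Otimes>\<^sub>M M \<rightarrow>\<^sub>M Y"
    and X2[measurable]: "(\<lambda>(\<theta>, \<omega>). X2 \<theta> \<omega>) \<in> P2 \<Otimes>\<^sub>M M \<rightarrow>\<^sub>M Y"
    and A[measurable]: "A \<in> P1 \<rightarrow>\<^sub>M P2" and P2: "distr P1 P2 A = P2"
    and T[measurable]: "T \<in> Y \<rightarrow>\<^sub>M Y" and T'[measurable]: "T' \<in> Y \<rightarrow>\<^sub>M Y"
    and T'_T: "\<And>y. y \<in> space Y \<Longrightarrow> T' (T y) = y"
    and T_X: "\<And>\<theta> \<omega>. \<theta> \<in> space P1 \<Longrightarrow> \<omega> \<in> space M \<Longrightarrow> T (X1 \<theta> \<omega>) = X2 (A \<theta>) \<omega>"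
    and S[measurable]: "S \<in> sets (Y \<Otimes>\<^sub>M P2)"
  shows "AE y in distr (P1 \<Otimes>\<^sub>M M) Y (\<lambda>(\<theta>, \<omega>). X1 \<theta> \<omega>).
    emeasure (\<kappa>1 y) {\<theta> \<in> space P1. (T y, A \<theta>) \<in> S} = emeasure (\<kappa>2 (T y)) (Pair (T y) -` S)"
proof -
  interpret M: prob_space M by (rule prob)
  interpret P1: prob_space P1 by (rule prob)
  interpret P2: prob_space P2 by (rule prob)
  interpret P1M: pair_prob_space P1 M ..
  let ?X1 = "\<lambda>(\<theta>, \<omega>). X1 \<theta> \<omega>" and ?X2 = "\<lambda>(\<theta>, \<omega>). X2 \<theta> \<omega>"
  let ?A = "\<lambda>(\<theta>, \<omega>). (A \<theta>, \<omega>)"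
  let ?m1 = "distr (P1 \<Otimes>\<^sub>M M) Y ?X1" and ?m2 = "distr (P2 \<Otimes>\<^sub>M M) Y ?X2"
  let ?F1 = "\<lambda>y. emeasure (\<kappa>1 y) {\<theta> \<in> space P1. (T y, A \<theta>) \<in> S}"
  let ?F2 = "\<lambda>y. emeasure (\<kappa>2 (T y)) (Pair (T y) -` S)"
  have \<kappa>: "\<kappa>1 \<in> Y \<rightarrow>\<^sub>M prob_algebra P1" "\<kappa>2 \<in> Y \<rightarrow>\<^sub>M prob_algebra P2"
    using post1 post2 by (auto simp: posterior_def)
  have joint: "distr (P1 \<Otimes>\<^sub>M M) (P2 \<Otimes>\<^sub>M M) ?A = P2 \<Otimes>\<^sub>M M"
    using pair_measure_distr[of A P1 P2 "\<lambda>\<omega>. \<omega>" M M] P2 M.sigma_finite_measure_axioms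
    by (simp add: distr_id2)
  have A_meas[measurable]: "?A \<in> P1 \<Otimes>\<^sub>M M \<rightarrow>\<^sub>M P2 \<Otimes>\<^sub>M M" by measurable
  have T_X': "T (?X1 z) = ?X2 (?A z)" if "z \<in> space (P1 \<Otimes>\<^sub>M M)" for z
    using that T_X by (auto simp: space_pair_measure)
  have marginal: "?m2 = distr ?m1 Y T"
  proof -
    have "?m2 = distr (distr (P1 \<Otimes>\<^sub>M M) (P2 \<Otimes>\<^sub>M M) ?A) Y ?X2" by (simp only: joint)
    also have "\<dots> = distr (P1 \<Otimes>\<^sub>M M) Y (\<lambda>z. ?X2 (?A z))"
      by (subst distr_distr) (auto simp: comp_def)
    also have "\<dots> = distr (P1 \<Otimes>\<^sub>M M) Y (\<lambda>z. T (?X1 z))"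
      by (intro distr_cong refl) (simp add: T_X')
    also have "\<dots> = distr ?m1 Y T"
      by (subst distr_distr) (auto simp: comp_def)
    finally show ?thesis .
  qed
  define S1 where "S1 = {(y, \<theta>) \<in> space (Y \<Otimes>\<^sub>M P1). (T y, A \<theta>) \<in> S}"
  have S1[measurable]: "S1 \<in> sets (Y \<Otimes>\<^sub>M P1)"
  proof -
    have "S1 = (\<lambda>(y, \<theta>). (T y, A \<theta>)) -` S \<inter> space (Y \<Otimes>\<^sub>M P1)" by (auto simp: S1_def)
    then show ?thesis by simp
  qed
  have S1_section: "Pair y -` S1 = {\<theta> \<in> space P1. (T y, A \<theta>) \<in> S}" if "y \<in> space Y" for y
    using that by (auto simp: S1_def space_pair_measure)
  have F1_meas: "?F1 \<in> borel_measurable ?m1"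
  proof -
    have "(SIGMA y:space Y. {\<theta> \<in> space P1. (T y, A \<theta>) \<in> S}) = S1"
      by (auto simp: S1_def space_pair_measure)
    then have "?F1 \<in> borel_measurable Y"
      using S1 \<kappa>(1) by (intro emeasure_measurable_subprob_algebra2[where N=P1])
        (auto intro: measurable_prob_algebraD)
    then show ?thesis by simp
  qed
  have F2_meas: "(\<lambda>y. emeasure (\<kappa>2 y) (Pair y -` S)) \<in> borel_measurable Y"
  proof -
    have "(SIGMA y:space Y. Pair y -` S) = S"
      using sets.sets_into_space[OF S] by (auto simp: space_pair_measure)
    then show ?thesis
      using S \<kappa>(2) by (intro emeasure_measurable_subprob_algebra2[where N=P2])
        (auto intro: measurable_prob_algebraD)
  qed
  have "density ?m1 ?F1 = density ?m1 ?F2"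
  proof (rule measure_eqI)
    fix E assume "E \<in> sets (density ?m1 ?F1)"
    then have E[measurable]: "E \<in> sets Y" by simp
    \<comment> \<open>By injectivity of \<open>T\<close>, \<open>E'\<close> pulls back to \<open>E\<close> along \<open>T\<close>.\<close>
    define E' where "E' = T' -` E \<inter> space Y"
    have E'[measurable]: "E' \<in> sets Y" unfolding E'_def by measurable
    have T_E': "T y \<in> E' \<longleftrightarrow> y \<in> E" if "y \<in> space Y" for y
      using that T'_T measurable_space[OF T] by (auto simp: E'_def)
    have rect[measurable]: "S1 \<inter> E \<times> space P1 \<in> sets (Y \<Otimes>\<^sub>M P1)" "S \<inter> E' \<times> space P2 \<in> sets (Y \<Otimes>\<^sub>M P2)"
      by measurable
    have "emeasure (density ?m1 ?F1) E = (\<integral>\<^sup>+y. ?F1 y * indicator E y \<partial>?m1)"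
      using F1_meas by (subst emeasure_density) auto
    also have "\<dots> = (\<integral>\<^sup>+y. emeasure (\<kappa>1 y) (Pair y -` (S1 \<inter> E \<times> space P1)) \<partial>?m1)"
      by (intro nn_integral_cong) (auto simp: S1_section split: split_indicator
          intro!: arg_cong[where f="emeasure _"])
    also have "\<dots> = emeasure (P1 \<Otimes>\<^sub>M M) {(\<theta>, \<omega>) \<in> space (P1 \<Otimes>\<^sub>M M). (X1 \<theta> \<omega>, \<theta>) \<in> S1 \<inter> E \<times> space P1}"
      by (rule posterior_disintegration[symmetric, OF post1 prob(2,1) X1 rect(1)])
    also have "{(\<theta>, \<omega>) \<in> space (P1 \<Otimes>\<^sub>M M). (X1 \<theta> \<omega>, \<theta>) \<in> S1 \<inter> E \<times> space P1}
        = ?A -` {(v, \<omega>) \<in> space (P2 \<Otimes>\<^sub>M M). (X2 v \<omega>, v) \<in> S \<inter> E' \<times> space P2} \<inter> space (P1 \<Otimes>\<^sub>M M)"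
    proof -
      have "X1 \<theta> \<omega> \<in> space Y" if "\<theta> \<in> space P1" "\<omega> \<in> space M" for \<theta> \<omega>
        using measurable_space[OF X1, of "(\<theta>, \<omega>)"] that by (simp add: space_pair_measure)
      then show ?thesis
        using measurable_space[OF A] T_X T_E' by (force simp: S1_def space_pair_measure)
    qed
    also have "emeasure (P1 \<Otimes>\<^sub>M M) \<dots>
        = emeasure (distr (P1 \<Otimes>\<^sub>M M) (P2 \<Otimes>\<^sub>M M) ?A)
            {(v, \<omega>) \<in> space (P2 \<Otimes>\<^sub>M M). (X2 v \<omega>, v) \<in> S \<inter> E' \<times> space P2}"
    proof (rule emeasure_distr[symmetric, OF A_meas])
      have "(\<lambda>(v, \<omega>). (X2 v \<omega>, v)) \<in> P2 \<Otimes>\<^sub>M M \<rightarrow>\<^sub>M Y \<Otimes>\<^sub>M P2"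
        using X2 by (simp add: case_prod_beta')
      from measurable_sets[OF this rect(2)]
      show "{(v, \<omega>) \<in> space (P2 \<Otimes>\<^sub>M M). (X2 v \<omega>, v) \<in> S \<inter> E' \<times> space P2} \<in> sets (P2 \<Otimes>\<^sub>M M)"
        by (rule back_subst[of "\<lambda>B. B \<in> _"]) auto
    qed
    also have "\<dots> = (\<integral>\<^sup>+y. emeasure (\<kappa>2 y) (Pair y -` (S \<inter> E' \<times> space P2)) \<partial>?m2)"
      unfolding joint by (rule posterior_disintegration[OF post2 prob(3,1) X2 rect(2)])
    also have "\<dots> = (\<integral>\<^sup>+y. emeasure (\<kappa>2 y) (Pair y -` S) * indicator E' y \<partial>?m2)"
      using sets.sets_into_space[OF S]
      by (intro nn_integral_cong) (auto simp: space_pair_measure split: split_indicator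
          intro!: arg_cong[where f="emeasure _"])
    also have "\<dots> = (\<integral>\<^sup>+y. ?F2 y * indicator E' (T y) \<partial>?m1)"
      unfolding marginal using F2_meas by (subst nn_integral_distr) auto
    also have "\<dots> = (\<integral>\<^sup>+y. ?F2 y * indicator E y \<partial>?m1)"
      by (intro nn_integral_cong) (auto simp: T_E' split: split_indicator)
    also have "\<dots> = emeasure (density ?m1 ?F2) E"
      using measurable_compose[OF T F2_meas] by (subst emeasure_density) auto
    finally show "emeasure (density ?m1 ?F1) E = emeasure (density ?m1 ?F2) E" .
  qed simp
  moreover have "(\<integral>\<^sup>+y. ?F1 y \<partial>?m1) \<noteq> \<infinity>"
  proof -
    have "(\<integral>\<^sup>+y. ?F1 y \<partial>?m1) \<le> (\<integral>\<^sup>+y. 1 \<partial>?m1)"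
    proof (rule nn_integral_mono)
      fix y assume "y \<in> space ?m1"
      then have "prob_space (\<kappa>1 y)"
        using measurable_space[OF \<kappa>(1), of y] by (simp add: space_prob_algebra)
      then show "?F1 y \<le> 1" by (rule prob_space.emeasure_le_1)
    qed
    also have "\<dots> = emeasure ?m1 (space ?m1)" by simp
    also have "\<dots> < \<infinity>"
      using finite_measure.emeasure_finite[OF P1M.finite_measure_distr[OF X1]] by (simp add: top.not_eq_extremum)
    finally show ?thesis by simp
  qed
  ultimately show ?thesis
    using F1_meas measurable_compose[OF T F2_meas] by (subst (asm) finite_density_unique) auto
qed

section \<open>Credible sets in the semilinear inverse problem\<close>

context semilinear_inverse_problem
begin

text \<open>
  Through \<open>K\<close>, every element of \<open>L\<^sup>2(U)\<close> is in the range of \<open>L\<close>. The subspace property of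
  \<open>L\<^sup>2(U)\<close> thus follows from the linearity of \<open>L\<close>.
\<close>

lemma L2_on_eq_range: "L2_on U = L ` D"
  using operator(3) inverse_right by (metis image_eqI subsetI subset_antisym)

lemma subspace_L2_on: "subspace (L2_on U)"
  unfolding L2_on_eq_range subspace_def
proof (intro conjI ballI allI)
  have lin: "\<And>x y. x \<in> D \<Longrightarrow> y \<in> D \<Longrightarrow> L (x + y) = L x + L y" "\<And>c x. x \<in> D \<Longrightarrow> L (c *\<^sub>R x) = c *\<^sub>R L x"
    using operator(4) by (auto simp: linear_on_def)
  have zero: "0 \<in> D" using operator(1) by (rule subspace_0)
  show "0 \<in> L ` D" using lin(2)[OF zero, of 0] zero by (auto intro: rev_image_eqI)
  show "x + y \<in> L ` D" if "x \<in> L ` D" "y \<in> L ` D" for x y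
    using that lin(1)[symmetric] subspace_add[OF operator(1)] by auto
  show "c *\<^sub>R x \<in> L ` D" if "x \<in> L ` D" for c x
    using that lin(2)[symmetric] subspace_mul[OF operator(1)] by auto
qed

text \<open>
  Continuity of \<open>K\<close> makes the data of model (L) jointly measurable in parameter and noise, and, by
  the decomposition of \<open>u f\<close>, those of model (N) as well.
\<close>

lemma continuous_on_K: "continuous_on (L2_on U) K"
proof -
  obtain B where B: "\<And>x. x \<in> L2_on U \<Longrightarrow> norm (K x) \<le> B * norm x"
    and lin: "linear_on (L2_on U) K"
    using inverse_bounded(2) by (auto simp: bounded_linear_on_def)
  have diff: "K (x - y) = K x - K y" if "x \<in> L2_on U" "y \<in> L2_on U" for x y
  proof -
    have "(-1) *\<^sub>R y \<in> L2_on U" using subspace_mul[OF subspace_L2_on that(2)] .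
    then have "K (x + (-1) *\<^sub>R y) = K x + (-1) *\<^sub>R K y"
      using lin that unfolding linear_on_def by metis
    then show ?thesis by simp
  qed
  have "\<bar>B\<bar>-lipschitz_on (L2_on U) K"
  proof (rule lipschitz_onI)
    fix x y assume xy: "x \<in> L2_on U" "y \<in> L2_on U"
    have "dist (K x) (K y) = norm (K (x - y))" by (simp add: diff[OF xy] dist_norm)
    also have "\<dots> \<le> B * norm (x - y)" by (rule B) (rule subspace_diff[OF subspace_L2_on xy])
    also have "\<dots> \<le> \<bar>B\<bar> * norm (x - y)" by (intro mult_right_mono) auto
    finally show "dist (K x) (K y) \<le> \<bar>B\<bar> * dist x y" by (simp add: dist_norm)
  qed simp
  then show ?thesis by (rule lipschitz_on_continuous_on)
qed

lemma solution_in_L2_on: "f \<in> F \<Longrightarrow> u f \<in> L2_on U" and L_solution_in_L2_on: "f \<in> F \<Longrightarrow> L (u f) \<in> L2_on U"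
  using solution[of f "u f"] operator(2,3) by auto

end

text \<open>
  Two points of a ball of radius \<open>r\<close> have distance at most \<open>2 * r\<close>, so that the images of all of its
  points are within \<open>\<omega> (2 * r)\<close> of \<open>e v0\<close>.
\<close>

lemma diameter_image_le:
  fixes e :: "'a::real_normed_vector \<Rightarrow> 'b::real_normed_vector"
  assumes mono: "mono_on {0..} \<omega>"
    and modulus: "\<And>v. v \<in> B \<Longrightarrow> norm (e v - e v0) \<le> \<omega> (norm (v - v0))"
    and B: "B \<subseteq> cball c r" and v0: "v0 \<in> B" and G: "G \<subseteq> e ` B" "G \<noteq> {}"
  shows "bounded G \<and> diameter G \<le> 2 * \<omega> (2 * r)"
proof -
  have near: "norm (x - e v0) \<le> \<omega> (2 * r)" if "x \<in> G" for x
  proof -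
    have "x \<in> e ` B" using that G(1) by blast
    then obtain v where v: "v \<in> B" "x = e v" by blast
    have "norm (v - v0) \<le> 2 * r"
    proof -
      have "norm (v - c) \<le> r" "norm (v0 - c) \<le> r"
        using B v(1) v0 by (auto simp: subset_eq dist_norm norm_minus_commute)
      then show ?thesis using norm_triangle_ineq4[of "v - c" "v0 - c"] by simp
    qed
    then have "\<omega> (norm (v - v0)) \<le> \<omega> (2 * r)"
      using norm_ge_zero[of "v - v0"] by (intro mono_onD[OF mono]) (simp_all del: norm_ge_zero)
    then show ?thesis using modulus[OF v(1)] v(2) by simp
  qed
  have "bounded G"
  proof (rule boundedI)
    show "norm x \<le> norm (e v0) + \<omega> (2 * r)" if "x \<in> G" for x
      using near[OF that] norm_triangle_sub[of x "e v0"] by linarith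
  qed
  moreover have "dist x y \<le> 2 * \<omega> (2 * r)" if "x \<in> G" "y \<in> G" for x y
    using dist_triangle2[of x y "e v0"] near[OF that(1)] near[OF that(2)] by (simp add: dist_norm)
  then have "diameter G \<le> 2 * \<omega> (2 * r)"
    using G(2) by (intro diameter_le) (auto simp: dist_norm)
  ultimately show ?thesis by blast
qed

theorem proposition3p2:
  fixes U :: "(real^'d) set"
    and D F :: "'d L2 set"
    and L K u e :: "'d L2 \<Rightarrow> 'd L2"
    and bd :: "'d L2 \<Rightarrow> 'b::real_vector"
    and g :: 'b
    and C :: "'d L2 \<Rightarrow> 'd L2 \<Rightarrow> 'd L2"
    and h gt f0 v0 :: "'d L2"
    and M :: "'w measure"
    and \<Xi> :: "'d L2 \<Rightarrow> 'w \<Rightarrow> real"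
    and Pt P :: "nat \<Rightarrow> 'd L2 measure"
    and post_v post_f :: "nat \<Rightarrow> ('d L2 \<Rightarrow> real) \<Rightarrow> 'd L2 measure"
    and Ct Cf :: "nat \<Rightarrow> ('d L2 \<Rightarrow> real) \<Rightarrow> 'd L2 set"
  defines "V \<equiv> L2_on U"
  assumes problem: "semilinear_inverse_problem U D L bd g K C h F u gt e"
    and noise: "white_noise M V \<Xi>"
    and truth: "f0 \<in> F" "v0 = L (u f0)"
    and prior_v: "\<And>n. n \<ge> 1 \<Longrightarrow> prior_on V (Pt n)"
    and prior_f: "\<And>n. n \<ge> 1 \<Longrightarrow> induced_prior V F (\<lambda>f. L (u f)) e (Pt n) (P n)"
    and posterior_L: "\<And>n. n \<ge> 1 \<Longrightarrow>
          posterior M (data_space V) (\<lambda>v. observation V \<Xi> n (K v)) (Pt n) (post_v n)"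
    and posterior_N: "\<And>n. n \<ge> 1 \<Longrightarrow>
          posterior M (data_space V) (\<lambda>f. observation V \<Xi> n (u f)) (P n) (post_f n)"
    and credible_v: "\<And>n. n \<ge> 1 \<Longrightarrow> measurable_set_estimator V (Ct n)"
    and credible_f: "\<And>n. n \<ge> 1 \<Longrightarrow> Cf n = pulled_back_set V F (\<lambda>f. L (u f)) gt (Ct n)"
  shows
    "(\<forall>n\<ge>1. \<forall>f\<in>F. AE y in data_law M V \<Xi> n (u f).
        measure (post_f n y) (Cf n y)
          = measure (post_v n (data_minus V y gt)) (Ct n (data_minus V y gt))) \<and>
     (\<forall>n\<ge>1.
        measure (data_law M V \<Xi> n (u f0)) {y \<in> space (data_space V). f0 \<in> Cf n y}
          = measure (data_law M V \<Xi> n (K v0)) {y \<in> space (data_space V). v0 \<in> Ct n y}) \<and>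
     (\<forall>n\<ge>1. \<forall>Vn \<omega>.
        Vn \<in> sets (borel_on V) \<and>
        (\<forall>t\<ge>0. 0 \<le> \<omega> t) \<and> mono_on {0..} \<omega> \<and> (\<omega> \<longlongrightarrow> 0) (at_right 0) \<and>
        (\<forall>v\<in>Vn. norm (e v - e v0) \<le> \<omega> (norm (v - v0)))
        \<longrightarrow> (\<forall>y\<in>space (data_space V). \<forall>c\<in>V. \<forall>r.
              Ct n (data_minus V y gt) \<subseteq> Vn \<and>
              Ct n (data_minus V y gt) = {v \<in> V. norm (v - c) \<le> r} \<and>
              v0 \<in> Ct n (data_minus V y gt)
              \<longrightarrow> bounded (Cf n y) \<and> diameter (Cf n y) \<le> 2 * \<omega> (2 * r)))"
proof -
  interpret semilinear_inverse_problem U D L bd g K C h F u gt e by (rule problem)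
  have M: "prob_space M" and \<Xi>: "\<And>\<phi>. \<phi> \<in> V \<Longrightarrow> \<Xi> \<phi> \<in> borel_measurable M"
    using noise by (auto simp: white_noise_def)
  let ?A = "\<lambda>f. L (u f)"
  let ?T = "\<lambda>y. data_minus V y gt"
  let ?graph = "\<lambda>n. {(y, v) \<in> space (data_space V \<Otimes>\<^sub>M borel_on V). v \<in> Ct n y}"
  have u_in_V: "u f \<in> V" and A_in_V: "?A f \<in> V" if "f \<in> F" for f
    using that solution_in_L2_on L_solution_in_L2_on by (auto simp: V_def)
  have graph: "?graph n \<in> sets (data_space V \<Otimes>\<^sub>M borel_on V)"
    and Ct_sub: "\<And>y. y \<in> space (data_space V) \<Longrightarrow> Ct n y \<subseteq> V" if "n \<ge> 1" for n
    using credible_v[OF that] by (auto simp: measurable_set_estimator_def)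
  have T_space: "?T y \<in> space (data_space V)" if "y \<in> space (data_space V)" for y
    using measurable_space[OF measurable_data_minus that] .
  have graph_section: "Pair y -` ?graph n = Ct n y" if "n \<ge> 1" "y \<in> space (data_space V)" for n y
    using Ct_sub[OF that] that(2) by (auto simp: space_pair_measure space_restrict_space)
  have T_obs: "?T (observation V \<Xi> n (u f) \<omega>) = observation V \<Xi> n (K (?A f)) \<omega>" if "f \<in> F" for n f \<omega>
    using data_minus_observation[of V \<Xi> n "K (?A f)" gt] decomposition[OF that] by simp

  have credibility: "AE y in data_law M V \<Xi> n (u f).
      measure (post_f n y) (Cf n y) = measure (post_v n (?T y)) (Ct n (?T y))"
    if n: "n \<ge> 1" and f: "f \<in> F" for n f
  proof -
    have Pt: "prob_space (Pt n)" "sets (Pt n) = sets (borel_on V)"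
      using prior_v[OF n] by (auto simp: prior_on_def)
    have P: "prob_space (P n)" "sets (P n) = sets (borel_on F)"
      and A: "?A \<in> P n \<rightarrow>\<^sub>M borel_on V" and push: "distr (P n) (borel_on V) ?A = Pt n"
      using prior_f[OF n] by (auto simp: induced_prior_def prior_on_def)
    have space_P: "space (P n) = F"
      using sets_eq_imp_space_eq[OF P(2)] by (simp add: space_restrict_space)
    have A_Pt: "?A \<in> P n \<rightarrow>\<^sub>M Pt n"
      using A by (simp cong: measurable_cong_sets add: Pt(2))
    have K_meas: "K \<in> borel_measurable (borel_on V)"
      using continuous_on_K by (simp add: V_def borel_measurable_continuous_on_restrict)
    have K_Pt: "K \<in> borel_measurable (Pt n)"
      using K_meas by (simp add: measurable_cong_sets[OF Pt(2) refl])
    have u_P: "u \<in> borel_measurable (P n)"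
    proof -
      have "(\<lambda>w. w + gt) \<in> borel_measurable borel"
        by (intro borel_measurable_continuous_onI continuous_intros)
      then have "(\<lambda>f. K (?A f) + gt) \<in> borel_measurable (P n)"
        using measurable_compose[OF measurable_compose[OF A K_meas]] by blast
      then show ?thesis
        by (rule measurable_cong[THEN iffD2, rotated]) (use decomposition space_P in blast)
    qed
    let ?X = "\<lambda>f. observation V \<Xi> n (u f)"
    have X: "(\<lambda>(f, \<omega>). ?X f \<omega>) \<in> P n \<Otimes>\<^sub>M M \<rightarrow>\<^sub>M data_space V"
      by (rule measurable_observation_pair[OF \<Xi> u_P])
    have "AE y in distr (P n \<Otimes>\<^sub>M M) (data_space V) (\<lambda>(f, \<omega>). ?X f \<omega>).
      emeasure (post_f n y) {f \<in> space (P n). (?T y, ?A f) \<in> ?graph n}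
        = emeasure (post_v n (?T y)) (Pair (?T y) -` ?graph n)"
    proof (rule AE_posterior_mass_eq[where T'="\<lambda>y. data_minus V y (- gt)",
          OF posterior_N[OF n] posterior_L[OF n] M P(1) Pt(1) X measurable_observation_pair[OF \<Xi> K_Pt] A_Pt])
      show "distr (P n) (Pt n) ?A = Pt n"
        using push by (simp cong: distr_cong add: Pt(2))
      show "?graph n \<in> sets (data_space V \<Otimes>\<^sub>M Pt n)"
        using graph[OF n] by (simp cong: sets_pair_measure_cong add: Pt(2))
    qed (auto intro!: measurable_data_minus data_minus_uminus T_obs simp: space_P)
    then have "AE y in data_law M V \<Xi> n (u f).
      emeasure (post_f n y) {f \<in> space (P n). (?T y, ?A f) \<in> ?graph n}
        = emeasure (post_v n (?T y)) (Pair (?T y) -` ?graph n)"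
      by (rule AE_data_law_of_AE_marginal[OF noise n P(1) u_P u_in_V _ u_in_V[OF f], rotated])
        (simp add: space_P)
    then show ?thesis
      using AE_space
    proof eventually_elim
      case (elim y)
      then have y: "y \<in> space (data_space V)" by (simp add: data_law_def)
      have "{f \<in> space (P n). (?T y, ?A f) \<in> ?graph n} = Cf n y"
        using T_space[OF y] A_in_V
        by (auto simp: credible_f[OF n] pulled_back_set_def space_P space_pair_measure space_restrict_space)
      then show ?case
        using elim(1) graph_section[OF n T_space[OF y]] by (simp add: measure_def)
    qed
  qed

  have coverage: "measure (data_law M V \<Xi> n (u f0)) {y \<in> space (data_space V). f0 \<in> Cf n y}
      = measure (data_law M V \<Xi> n (K v0)) {y \<in> space (data_space V). v0 \<in> Ct n y}"
    if n: "n \<ge> 1" for n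
  proof -
    have v0: "v0 \<in> V" using A_in_V truth by simp
    have "(\<lambda>y. (y, v0)) \<in> data_space V \<rightarrow>\<^sub>M data_space V \<Otimes>\<^sub>M borel_on V"
      using v0 by (intro measurable_Pair2') (simp add: space_restrict_space)
    from measurable_sets[OF this graph[OF n]]
    have covering: "{y \<in> space (data_space V). v0 \<in> Ct n y} \<in> sets (data_space V)"
      by (rule back_subst[of "\<lambda>B. B \<in> _"]) (use v0 in \<open>auto simp: space_pair_measure space_restrict_space\<close>)
    have obs: "observation V \<Xi> n w \<in> M \<rightarrow>\<^sub>M data_space V" for w
      by (rule measurable_observation[OF \<Xi>])
    have "data_law M V \<Xi> n (K v0) = distr (data_law M V \<Xi> n (u f0)) (data_space V) ?T"
      unfolding data_law_def
      by (subst distr_distr[OF measurable_data_minus obs]) (simp add: comp_def T_obs truth)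
    then have "measure (data_law M V \<Xi> n (K v0)) {y \<in> space (data_space V). v0 \<in> Ct n y}
        = measure (data_law M V \<Xi> n (u f0))
            (?T -` {y \<in> space (data_space V). v0 \<in> Ct n y} \<inter> space (data_law M V \<Xi> n (u f0)))"
      using covering by (simp add: measure_distr data_law_def measurable_data_minus)
    also have "?T -` {y \<in> space (data_space V). v0 \<in> Ct n y} \<inter> space (data_law M V \<Xi> n (u f0))
        = {y \<in> space (data_space V). f0 \<in> Cf n y}"
      using truth T_space by (auto simp: data_law_def credible_f[OF n] pulled_back_set_def)
    finally show ?thesis by simp
  qed

  have diameter: "bounded (Cf n y) \<and> diameter (Cf n y) \<le> 2 * \<omega> (2 * r)"
    if n: "n \<ge> 1" and \<omega>: "mono_on {0..} \<omega>" "\<And>v. v \<in> Vn \<Longrightarrow> norm (e v - e v0) \<le> \<omega> (norm (v - v0))"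
      and Ct: "Ct n (?T y) \<subseteq> Vn" "Ct n (?T y) = {v \<in> V. norm (v - c) \<le> r}" "v0 \<in> Ct n (?T y)"
    for n Vn \<omega> y c r
  proof (rule diameter_image_le[where e=e and B="Ct n (?T y)" and c=c, OF \<omega>(1)])
    show "Ct n (?T y) \<subseteq> cball c r"
      using Ct(2) by (auto simp: dist_norm norm_minus_commute)
    show "Cf n y \<subseteq> e ` Ct n (?T y)"
      using solution_map(2) by (force simp: credible_f[OF n] pulled_back_set_def)
    show "Cf n y \<noteq> {}"
      using Ct(3) truth by (auto simp: credible_f[OF n] pulled_back_set_def)
  qed (use \<omega>(2) Ct in auto)

  show ?thesis
  proof (intro conjI[OF _ conjI] allI impI ballI, goal_cases)
    case (1 n f)
    then show ?case by (rule credibility)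
  next
    case (2 n)
    then show ?case by (rule coverage)
  next
    case (3 n Vn \<omega> y c r)
    then show ?case by (intro diameter[where Vn=Vn and c=c]) blast+
  qed
qed

end
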